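(* Let $m\ge r\ge 2$ be integers and $F$ a nondegenerate $r$-graph on $m$ vertices. Let $f\colon\mathbb{N}\to\mathbb{R}$ be a nondecreasing function. Suppose that for all sufficiently large $n\in\mathbb{N}$: (a) $|\delta(n,F)-d(n-1,F)|\le\frac{1-\pi(F)}{8m}\binom{n}{r-1}$, and (b) every $F$-free $r$-graph $\mathcal{H}$ on $n$ vertices with $d(\mathcal{H})\ge d(n,F)-f(n)$ satisfies $\Delta(\mathcal{H})\le d(n,F)+\frac{1-\pi(F)}{4m}\binom{n}{r-1}$. Then there exists $N_0$ such that for all integers $n,t\in\mathbb{N}$ with \[ n\ge N_0,\quad t\le\frac{1-\pi(F)}{64rm^2}n,\quad\text{and}\quad 2emt\binom{n-2mt}{r-2}\le f(n-2mt), \] the following hold. (i) If a collection $\{\mathcal{H}_1,\dots,\mathcal{H}_{t+1}\}$ of $n$-vertex $r$-graphs on the same vertex set satisfies $|\mathcal{H}_i|>\binom{n}{r}-\binom{n-t}{r}+\mathrm{ex}(n-t,F)$ for all $i\in[t+1]$, then $\{\mathcal{H}_1,\dots,\mathcal{H}_{t+1}\}$ contains a rainbow $F$-matching. (ii) $\mathrm{EX}(n,(t+1)F)=K_t^r\bowtie\mathrm{EX}(n-t,F)$.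
   Context: An $r$-graph is a collection of $r$-subsets of a finite vertex set, considered up to isomorphism. $\nu(F,\mathcal{H})$ is the maximum number of pairwise vertex-disjoint copies of $F$ in $\mathcal{H}$. $\mathrm{ex}(n,F)$ is the maximum number of edges of an $n$-vertex $F$-free $r$-graph and $\mathrm{EX}(n,F)$ the set of $n$-vertex $F$-free $r$-graphs attaining it; $\mathrm{EX}(n,(t+1)F)$ is the set of $n$-vertex $r$-graphs $\mathcal{H}$ with $\nu(F,\mathcal{H})<t+1$ having the maximum possible number of edges among such. $\pi(F)=\lim\mathrm{ex}(n,F)/\binom{n}{r}$; nondegenerate means $\pi(F)>0$. $d(n,F):=r\cdot\mathrm{ex}(n,F)/n$, $\delta(n,F):=\mathrm{ex}(n,F)-\mathrm{ex}(n-1,F)$; $d(\mathcal{H})$, $\Delta(\mathcal{H})$ are average and maximum degree. A collection $\{\mathcal{H}_1,\dots,\mathcal{H}_{t+1}\}$ on common vertex set $V$ contains a rainbow $F$-matching if there are pairwise disjoint $m$-subsets $S_1,\dots,S_{t+1}$ of $V$ with $F\subseteq\mathcal{H}_i[S_i]$ for all $i$. $K_t^r$ is the complete $r$-graph on $t$ vertices; the join $\mathcal{G}\bowtie\mathcal{H}$ of $r$-graphs on disjoint vertex sets consists of the edges of both together with all $r$-subsets of $V(\mathcal{G})\cup V(\mathcal{H})$ meeting both vertex sets, and $\mathcal{G}\bowtie\mathcal{F}=\{\mathcal{G}\bowtie\mathcal{H}:\mathcal{H}\in\mathcal{F}\}$. *)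

theory Defs
  imports Complex_Main "HOL-Library.Disjoint_Sets"
begin

text \<open>
  The edge set alone does not determine isolated vertices, so a hypergraph carries its vertex set.
\<close>

datatype 'a hypergraph = Hypergraph (verts: "'a set") (edges: "'a set set")

definition rgraph :: "nat \<Rightarrow> 'a hypergraph \<Rightarrow> bool" where
  "rgraph r H \<longleftrightarrow> finite (verts H) \<and> (\<forall>e\<in>edges H. e \<subseteq> verts H \<and> card e = r)"

definition subhypergraph :: "'a hypergraph \<Rightarrow> 'a hypergraph \<Rightarrow> bool" where
  "subhypergraph G H \<longleftrightarrow> verts G \<subseteq> verts H \<and> edges G \<subseteq> edges H \<and> (\<forall>e\<in>edges G. e \<subseteq> verts G)"

definition isomorphic :: "'a hypergraph \<Rightarrow> 'b hypergraph \<Rightarrow> bool" where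
  "isomorphic G H \<longleftrightarrow>
     (\<exists>\<phi>. bij_betw \<phi> (verts G) (verts H) \<and> (\<lambda>e. \<phi> ` e) ` edges G = edges H)"

text \<open>Copies are not required to be induced.\<close>

definition copy_of :: "'a hypergraph \<Rightarrow> 'b hypergraph \<Rightarrow> 'b hypergraph \<Rightarrow> bool" where
  "copy_of F H C \<longleftrightarrow> subhypergraph C H \<and> isomorphic F C"

definition contains_copy :: "'a hypergraph \<Rightarrow> 'b hypergraph \<Rightarrow> bool" where
  "contains_copy F H \<longleftrightarrow> (\<exists>C. copy_of F H C)"

definition free_of :: "'a hypergraph \<Rightarrow> 'b hypergraph \<Rightarrow> bool" where
  "free_of F H \<longleftrightarrow> \<not> contains_copy F H"

definition induced :: "'a hypergraph \<Rightarrow> 'a set \<Rightarrow> 'a hypergraph" where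
  "induced H S = Hypergraph S {e \<in> edges H. e \<subseteq> S}"

definition matching_number :: "'a hypergraph \<Rightarrow> 'b hypergraph \<Rightarrow> nat" where
  "matching_number F H =
     Max {card \<C> | \<C>. (\<forall>C\<in>\<C>. copy_of F H C) \<and> disjoint_family_on verts \<C>}"

definition degree :: "'a hypergraph \<Rightarrow> 'a \<Rightarrow> nat" where
  "degree H v = card {e \<in> edges H. v \<in> e}"

definition avg_degree :: "'a hypergraph \<Rightarrow> real" where
  "avg_degree H = (\<Sum>v\<in>verts H. real (degree H v)) / real (card (verts H))"

definition max_degree :: "'a hypergraph \<Rightarrow> nat" where
  "max_degree H = Max (degree H ` verts H)"

text \<open>
  Finite hypergraphs matter only up to isomorphism, so host hypergraphs are taken with vertices in
  \<^typ>\<open>nat\<close>.  A family of isomorphism types is represented by the set of all its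
  representatives over \<^typ>\<open>nat\<close>; with this convention equality of families is equality of
  sets.
\<close>

definition nvertex_rgraphs :: "nat \<Rightarrow> nat \<Rightarrow> nat hypergraph set" where
  "nvertex_rgraphs r n = {H. rgraph r H \<and> card (verts H) = n}"

definition ex_num :: "nat \<Rightarrow> nat \<Rightarrow> 'a hypergraph \<Rightarrow> nat" where
  "ex_num r n F = Max {card (edges H) | H. H \<in> nvertex_rgraphs r n \<and> free_of F H}"

definition EX_graphs :: "nat \<Rightarrow> nat \<Rightarrow> 'a hypergraph \<Rightarrow> nat hypergraph set" where
  "EX_graphs r n F = {H \<in> nvertex_rgraphs r n. free_of F H \<and> card (edges H) = ex_num r n F}"

text \<open>\<open>EX_matching r n k F\<close> is the family usually written EX(n,kF), with kF a disjoint union of k copies of F.\<close>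

definition EX_matching :: "nat \<Rightarrow> nat \<Rightarrow> nat \<Rightarrow> 'a hypergraph \<Rightarrow> nat hypergraph set" where
  "EX_matching r n k F =
     {H \<in> nvertex_rgraphs r n. matching_number F H < k \<and>
        (\<forall>H'\<in>nvertex_rgraphs r n. matching_number F H' < k \<longrightarrow> card (edges H') \<le> card (edges H))}"

definition turan_density :: "nat \<Rightarrow> 'a hypergraph \<Rightarrow> real" where
  "turan_density r F = lim (\<lambda>n. real (ex_num r n F) / real (n choose r))"

definition nondegenerate :: "nat \<Rightarrow> 'a hypergraph \<Rightarrow> bool" where
  "nondegenerate r F \<longleftrightarrow> turan_density r F > 0"

definition d_ex :: "nat \<Rightarrow> nat \<Rightarrow> 'a hypergraph \<Rightarrow> real" where
  "d_ex r n F = real r * real (ex_num r n F) / real n"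

definition delta_ex :: "nat \<Rightarrow> nat \<Rightarrow> 'a hypergraph \<Rightarrow> real" where
  "delta_ex r n F = real (ex_num r n F) - real (ex_num r (n - 1) F)"

definition contains_rainbow_matching ::
  "'a hypergraph \<Rightarrow> nat \<Rightarrow> 'b set \<Rightarrow> (nat \<Rightarrow> 'b hypergraph) \<Rightarrow> bool" where
  "contains_rainbow_matching F k V \<H> \<longleftrightarrow>
     (\<exists>S. (\<forall>i\<in>{1..k}. S i \<subseteq> V \<and> card (S i) = card (verts F) \<and>
                       contains_copy F (induced (\<H> i) (S i))) \<and>
          disjoint_family_on S {1..k})"

definition join :: "nat \<Rightarrow> 'a hypergraph \<Rightarrow> 'a hypergraph \<Rightarrow> 'a hypergraph" where
  "join r G H = Hypergraph (verts G \<union> verts H)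
     (edges G \<union> edges H \<union>
      {e. e \<subseteq> verts G \<union> verts H \<and> card e = r \<and> e \<inter> verts G \<noteq> {} \<and> e \<inter> verts H \<noteq> {}})"

definition complete_rgraphs :: "nat \<Rightarrow> nat \<Rightarrow> nat hypergraph set" where
  "complete_rgraphs r t = {Hypergraph T {e. e \<subseteq> T \<and> card e = r} | T. finite T \<and> card T = t}"

text \<open>
  The single isomorphism type on the left of a join also enters through its set of
  representatives; the representatives being joined must have disjoint vertex sets.
\<close>

definition join_family :: "nat \<Rightarrow> 'a hypergraph set \<Rightarrow> 'a hypergraph set \<Rightarrow> 'a hypergraph set" where
  "join_family r \<G> \<F> = {join r G H | G H. G \<in> \<G> \<and> H \<in> \<F> \<and> verts G \<inter> verts H = {}}"

end

theory Submission
  imports Defs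
begin

text \<open>
  Call a vertex high in a hypergraph of the collection if its degree exceeds the typical degree
  \<open>\<pi> (n-1 choose r-1)\<close> by the margin \<open>(1 - \<pi>) / (2m) (n choose r-1)\<close>.  Take a maximal set of indices
  whose hypergraphs admit distinct high vertices, and let \<open>L\<close> be the set of these vertices.  Every other
  hypergraph has no high vertex outside \<open>L\<close>; if \<open>L\<close> has fewer than \<open>t\<close> elements, smoothness shows that removing the
  few vertices used so far leaves more edges than the extremal number, so copies of \<open>F\<close> avoiding
  \<open>L\<close> can be chosen greedily.  A hypergraph with a high vertex \<open>v\<close> still contains \<open>F\<close> after the deletion of \<open>m t\<close>
  vertices other than \<open>v\<close>, since otherwise boundedness would contradict the degree of \<open>v\<close>.  So the only
  obstruction to a rainbow matching is a set \<open>L\<close> of exactly \<open>t\<close> vertices whose removal makes some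
  member \<open>F\<close>-free; counting edges then gives the bound in (i), and its equality case gives (ii).
\<close>

section \<open>Copies of \<open>F\<close> and induced subhypergraphs\<close>

lemma contains_copy_mono:
  assumes "contains_copy F G" "verts G \<subseteq> verts H" "edges G \<subseteq> edges H"
  shows "contains_copy F H"
proof -
  obtain C where C: "copy_of F G C" using assms(1) unfolding contains_copy_def by blast
  then have "copy_of F H C" using assms(2,3) unfolding copy_of_def subhypergraph_def by auto
  then show ?thesis unfolding contains_copy_def by blast
qed

lemma contains_copy_induced_mono:
  assumes "contains_copy F (induced H S)" "S \<subseteq> T"
  shows "contains_copy F (induced H T)"
  by (rule contains_copy_mono[OF assms(1)]) (use assms(2) in \<open>auto simp: induced_def\<close>)

lemma copy_of_card_verts: "copy_of F H C \<Longrightarrow> card (verts C) = card (verts F)"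
  unfolding copy_of_def isomorphic_def using bij_betw_same_card by fastforce

lemma copy_of_induced_verts:
  assumes "copy_of F H C"
  shows "copy_of F (induced H (verts C)) C"
  using assms unfolding copy_of_def subhypergraph_def induced_def by auto

lemma copy_of_induced:
  assumes "copy_of F (induced H W) C"
  shows "verts C \<subseteq> W" and "W \<subseteq> verts H \<Longrightarrow> copy_of F H C"
    and "copy_of F (induced H (verts C)) C"
  using assms unfolding copy_of_def subhypergraph_def induced_def by auto

text \<open>The window \<open>W\<close> is cut down to the vertex set of the copy itself, which has
  exactly the size that \<open>contains_rainbow_matching\<close> demands.\<close>

lemma contains_copy_inducedE:
  assumes "contains_copy F (induced H W)"
  obtains S where "S \<subseteq> W" "card S = card (verts F)" "contains_copy F (induced H S)"
  using assms copy_of_induced copy_of_card_verts unfolding contains_copy_def by metis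

lemma rgraph_finite_edges: "rgraph r H \<Longrightarrow> finite (edges H)"
  unfolding rgraph_def by (meson Pow_iff finite_Pow_iff finite_subset subsetI)

lemma rgraph_induced: "rgraph r H \<Longrightarrow> S \<subseteq> verts H \<Longrightarrow> rgraph r (induced H S)"
  unfolding rgraph_def induced_def by (auto intro: finite_subset)

lemma induced_nvertex:
  assumes "H \<in> nvertex_rgraphs r n" "S \<subseteq> verts H" "card S = k"
  shows "induced H S \<in> nvertex_rgraphs r k"
  using assms rgraph_induced unfolding nvertex_rgraphs_def by (auto simp: induced_def)

lemma rgraph_card_edges_le:
  assumes "rgraph r H"
  shows "card (edges H) \<le> card (verts H) choose r"
proof -
  have "edges H \<subseteq> {e. e \<subseteq> verts H \<and> card e = r}" "finite {e. e \<subseteq> verts H \<and> card e = r}"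
    using assms unfolding rgraph_def by auto
  then have "card (edges H) \<le> card {e. e \<subseteq> verts H \<and> card e = r}" by (rule card_mono[rotated])
  also have "\<dots> = card (verts H) choose r" using assms by (simp add: n_subsets rgraph_def)
  finally show ?thesis .
qed

lemma contains_copy_edgeless:
  assumes "edges F = {}" "finite (verts F)" "finite (verts H)" "card (verts F) \<le> card (verts H)"
  shows "contains_copy F H"
proof -
  obtain S where S: "S \<subseteq> verts H" "card S = card (verts F)" "finite S"
    by (rule obtain_subset_with_card_n[OF assms(4)]) (use assms(3) in \<open>auto intro: finite_subset\<close>)
  then obtain \<phi> where "bij_betw \<phi> (verts F) S"
    using assms(2) finite_same_card_bij by metis
  then have "copy_of F H (Hypergraph S {})"
    using S assms(1) unfolding copy_of_def subhypergraph_def isomorphic_def by auto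
  then show ?thesis unfolding contains_copy_def by blast
qed

lemma free_of_edgeless:
  assumes "edges F \<noteq> {}" "edges H = {}"
  shows "free_of F H"
  using assms unfolding free_of_def contains_copy_def copy_of_def subhypergraph_def isomorphic_def
  by auto

section \<open>Extremal numbers are attained\<close>

text \<open>Infinitely many hosts over \<open>nat\<close> compete, but their edge counts are bounded
  by \<open>n choose r\<close>, so the \<open>Max\<close> in \<open>ex_num\<close> is taken over a
  finite set.\<close>

lemma finite_ex_num_set: "finite {card (edges H) | H. H \<in> nvertex_rgraphs r n \<and> free_of F H}"
proof (rule finite_subset)
  show "{card (edges H) | H. H \<in> nvertex_rgraphs r n \<and> free_of F H} \<subseteq> {..n choose r}"
    by (auto simp: nvertex_rgraphs_def dest: rgraph_card_edges_le)
qed simp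

lemma card_edges_le_ex_num:
  assumes "H \<in> nvertex_rgraphs r n" "free_of F H"
  shows "card (edges H) \<le> ex_num r n F"
  unfolding ex_num_def by (rule Max_ge[OF finite_ex_num_set]) (use assms in auto)

text \<open>If \<open>F\<close> has an edge, the edgeless hypergraph is \<open>F\<close>-free, so
  the \<open>Max\<close> in \<open>ex_num\<close> is attained.\<close>

lemma EX_graphs_nonempty:
  assumes "edges F \<noteq> {}"
  shows "EX_graphs r n F \<noteq> {}"
proof -
  let ?A = "{card (edges H) | H. H \<in> nvertex_rgraphs r n \<and> free_of F H}"
  have "Hypergraph {..<n} {} \<in> nvertex_rgraphs r n"
    by (auto simp: nvertex_rgraphs_def rgraph_def)
  then have "?A \<noteq> {}" using free_of_edgeless[OF assms, of "Hypergraph {..<n} {}"] by fastforce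
  then have "ex_num r n F \<in> ?A" unfolding ex_num_def by (rule Max_in[OF finite_ex_num_set])
  then show ?thesis unfolding EX_graphs_def by fastforce
qed

section \<open>Degrees and counting of edges\<close>

text \<open>Double counting of the incidences between \<open>B\<close> and the edges.\<close>

lemma sum_degree:
  assumes "rgraph r H" "B \<subseteq> verts H"
  shows "(\<Sum>v\<in>B. degree H v) = (\<Sum>e\<in>edges H. card (e \<inter> B))"
proof -
  have fB: "finite B" using assms unfolding rgraph_def by (auto intro: finite_subset)
  have "(\<Sum>v\<in>B. degree H v) = (\<Sum>v\<in>B. \<Sum>e\<in>edges H. if v \<in> e then 1 else 0)"
    using rgraph_finite_edges[OF assms(1)]
    by (simp add: degree_def sum.If_cases Int_def conj_commute)
  also have "\<dots> = (\<Sum>e\<in>edges H. \<Sum>v\<in>B. if v \<in> e then 1 else 0)" by (rule sum.swap)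
  also have "\<dots> = (\<Sum>e\<in>edges H. card (e \<inter> B))"
    using fB by (simp add: sum.If_cases Int_def conj_commute)
  finally show ?thesis .
qed

lemma handshake:
  assumes "rgraph r H"
  shows "(\<Sum>v\<in>verts H. degree H v) = r * card (edges H)"
proof -
  have "e \<inter> verts H = e" if "e \<in> edges H" for e using assms that unfolding rgraph_def by auto
  then show ?thesis using sum_degree[OF assms order.refl] assms
    unfolding rgraph_def by simp
qed

lemma avg_degree_eq: "rgraph r H \<Longrightarrow> avg_degree H = real r * real (card (edges H)) / real (card (verts H))"
  unfolding avg_degree_def using handshake[of r H]
  by (metis of_nat_mult of_nat_sum)

lemma degree_le_max_degree:
  assumes "rgraph r H" "v \<in> verts H"
  shows "degree H v \<le> max_degree H"
  using assms unfolding max_degree_def rgraph_def by simp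

lemma card_edges_split:
  assumes "rgraph r H" "B \<subseteq> verts H"
  shows "card (edges H) = card (edges (induced H (verts H - B))) + card {e \<in> edges H. e \<inter> B \<noteq> {}}"
proof -
  have "edges H = edges (induced H (verts H - B)) \<union> {e \<in> edges H. e \<inter> B \<noteq> {}}"
    using assms unfolding rgraph_def induced_def by auto
  moreover have "edges (induced H (verts H - B)) \<inter> {e \<in> edges H. e \<inter> B \<noteq> {}} = {}"
    unfolding induced_def by auto
  ultimately show ?thesis
    using card_Un_disjoint rgraph_finite_edges[OF assms(1)] finite_Un by metis
qed

lemma card_edges_meeting_le_sum_degree:
  assumes "rgraph r H" "B \<subseteq> verts H"
  shows "card {e \<in> edges H. e \<inter> B \<noteq> {}} \<le> (\<Sum>v\<in>B. degree H v)"
proof -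
  have fB: "finite B" using assms unfolding rgraph_def by (auto intro: finite_subset)
  have "{e \<in> edges H. e \<inter> B \<noteq> {}} = (\<Union>v\<in>B. {e \<in> edges H. v \<in> e})" by auto
  then show ?thesis unfolding degree_def using card_UN_le[OF fB] by metis
qed

lemma card_subsets_meeting:
  assumes "finite V" "L \<subseteq> V"
  shows "card {e. e \<subseteq> V \<and> card e = r \<and> e \<inter> L \<noteq> {}}
           = (card V choose r) - ((card V - card L) choose r)"
proof -
  have "{e. e \<subseteq> V \<and> card e = r \<and> e \<inter> L \<noteq> {}}
          = {e. e \<subseteq> V \<and> card e = r} - {e. e \<subseteq> V - L \<and> card e = r}" by auto
  moreover have "{e. e \<subseteq> V - L \<and> card e = r} \<subseteq> {e. e \<subseteq> V \<and> card e = r}" by auto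
  moreover have "card (V - L) = card V - card L"
    using assms finite_subset[OF assms(2,1)] by (simp add: card_Diff_subset)
  ultimately show ?thesis using assms
    by (simp add: card_Diff_subset n_subsets)
qed

lemma card_edges_meeting_le:
  assumes "rgraph r H" "L \<subseteq> verts H"
  shows "card {e \<in> edges H. e \<inter> L \<noteq> {}}
           \<le> (card (verts H) choose r) - ((card (verts H) - card L) choose r)"
proof -
  have "{e \<in> edges H. e \<inter> L \<noteq> {}} \<subseteq> {e. e \<subseteq> verts H \<and> card e = r \<and> e \<inter> L \<noteq> {}}"
    using assms unfolding rgraph_def by auto
  moreover have "finite {e. e \<subseteq> verts H \<and> card e = r \<and> e \<inter> L \<noteq> {}}"
    using assms unfolding rgraph_def by auto
  ultimately have "card {e \<in> edges H. e \<inter> L \<noteq> {}}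
      \<le> card {e. e \<subseteq> verts H \<and> card e = r \<and> e \<inter> L \<noteq> {}}"
    by (rule card_mono[rotated])
  then show ?thesis
    using card_subsets_meeting[OF _ assms(2), of r] assms(1) by (simp add: rgraph_def)
qed

lemma card_subsets_containing:
  assumes "finite V" "A \<subseteq> V" "card A \<le> r"
  shows "card {e. e \<subseteq> V \<and> card e = r \<and> A \<subseteq> e} = (card V - card A) choose (r - card A)"
proof -
  have fA: "finite A" using assms by (auto intro: finite_subset)
  have "bij_betw (\<lambda>e. e \<union> A) {e. e \<subseteq> V - A \<and> card e = r - card A} {e. e \<subseteq> V \<and> card e = r \<and> A \<subseteq> e}"
  proof (rule bij_betw_byWitness[where f' = "\<lambda>e. e - A"])
    show "(\<lambda>e. e \<union> A) ` {e. e \<subseteq> V - A \<and> card e = r - card A} \<subseteq> {e. e \<subseteq> V \<and> card e = r \<and> A \<subseteq> e}"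
    proof clarify
      fix e assume e: "e \<subseteq> V - A" "card e = r - card A"
      then have "finite e" "e \<inter> A = {}" using assms(1) finite_subset[of e V] by auto
      then show "e \<union> A \<subseteq> V \<and> card (e \<union> A) = r \<and> A \<subseteq> e \<union> A"
        using e assms fA by (auto simp: card_Un_disjoint)
    qed
    show "(\<lambda>e. e - A) ` {e. e \<subseteq> V \<and> card e = r \<and> A \<subseteq> e} \<subseteq> {e. e \<subseteq> V - A \<and> card e = r - card A}"
      using fA by (auto simp: card_Diff_subset)
  qed auto
  then have "card {e. e \<subseteq> V \<and> card e = r \<and> A \<subseteq> e} = card {e. e \<subseteq> V - A \<and> card e = r - card A}"
    by (rule bij_betw_same_card[symmetric])
  also have "\<dots> = (card V - card A) choose (r - card A)"
    using assms fA by (simp add: n_subsets card_Diff_subset)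
  finally show ?thesis .
qed

lemma degree_le:
  assumes "rgraph r H" "v \<in> verts H" "r \<ge> 1"
  shows "degree H v \<le> (card (verts H) - 1) choose (r - 1)"
proof -
  have "{e \<in> edges H. v \<in> e} \<subseteq> {e. e \<subseteq> verts H \<and> card e = r \<and> {v} \<subseteq> e}"
    using assms unfolding rgraph_def by auto
  moreover have "finite {e. e \<subseteq> verts H \<and> card e = r \<and> {v} \<subseteq> e}"
    using assms unfolding rgraph_def by auto
  ultimately have "degree H v \<le> card {e. e \<subseteq> verts H \<and> card e = r \<and> {v} \<subseteq> e}"
    unfolding degree_def by (rule card_mono[rotated])
  then show ?thesis
    using card_subsets_containing[of "verts H" "{v}" r] assms unfolding rgraph_def by simp
qed

text \<open>An edge through \<open>v\<close> that disappears with \<open>B\<close> contains a pair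
  \<open>{u, v}\<close> with \<open>u\<close> in \<open>B\<close>, and a fixed pair lies in only
  \<open>(card (verts H) - 2) choose (r - 2)\<close> candidate edges. Losing \<open>B\<close> is
  therefore cheap for a single degree.\<close>

lemma degree_induced_ge:
  assumes "rgraph r H" "B \<subseteq> verts H" "v \<in> verts H - B" "r \<ge> 2"
  shows "degree H v \<le> degree (induced H (verts H - B)) v + card B * ((card (verts H) - 2) choose (r - 2))"
proof -
  let ?X = "\<lambda>u. {e. e \<subseteq> verts H \<and> card e = r \<and> {u, v} \<subseteq> e}"
  have fV: "finite (verts H)" using assms unfolding rgraph_def by auto
  then have fB: "finite B" using assms by (auto intro: finite_subset)
  have "card (?X u) = (card (verts H) - 2) choose (r - 2)" if "u \<in> B" for u
  proof -
    have "u \<noteq> v" using that assms by auto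
    then show ?thesis using card_subsets_containing[OF fV, of "{u,v}" r] that assms by (auto simp: numeral_2_eq_2)
  qed
  then have "card (\<Union>u\<in>B. ?X u) \<le> card B * ((card (verts H) - 2) choose (r - 2))"
    using card_UN_le[OF fB, of ?X] by simp
  moreover have "{e \<in> edges H. v \<in> e}
      \<subseteq> {e \<in> edges (induced H (verts H - B)). v \<in> e} \<union> (\<Union>u\<in>B. ?X u)"
    using assms unfolding rgraph_def induced_def by auto
  then have "degree H v \<le> card ({e \<in> edges (induced H (verts H - B)). v \<in> e} \<union> (\<Union>u\<in>B. ?X u))"
    unfolding degree_def
    using fV fB rgraph_finite_edges[OF rgraph_induced[OF assms(1), of "verts H - B"]]
    by (intro card_mono finite_UnI finite_UN_I) auto
  ultimately show ?thesis
    unfolding degree_def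
    using card_Un_le[of "{e \<in> edges (induced H (verts H - B)). v \<in> e}" "\<Union>u\<in>B. ?X u"] by linarith
qed

section \<open>Greedy choice of disjoint copies\<close>

text \<open>The indices in \<open>J\<close> are already served, those in \<open>K\<close> are
  pending, and \<open>w k\<close> is a set reserved for \<open>k\<close> that no other index may
  touch. When an index is served, each other index blocks at most \<open>m\<close> vertices, through
  its chosen set or its reservation; this explains the bound
  \<open>m * (card (J \<union> K) - 1)\<close>.\<close>

lemma greedy_extension:
  fixes S w :: "'i \<Rightarrow> 'v set"
  assumes "finite K" "finite J" "J \<inter> K = {}"
    and "disjoint_family_on S J"
    and "\<And>i. i \<in> J \<Longrightarrow> finite (S i) \<and> card (S i) = m \<and> S i \<inter> (\<Union>k\<in>K. w k) = {}"
    and "\<And>k. k \<in> K \<Longrightarrow> finite (w k) \<and> card (w k) \<le> m"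
    and "disjoint_family_on w K"
    and "\<And>i B. \<lbrakk>i \<in> K; finite B; B \<inter> w i = {}; card B \<le> m * (card (J \<union> K) - 1)\<rbrakk>
           \<Longrightarrow> \<exists>T. Q i T \<and> finite T \<and> card T = m \<and> T \<inter> B = {}"
  shows "\<exists>S'. (\<forall>i\<in>J. S' i = S i) \<and> (\<forall>i\<in>K. Q i (S' i)) \<and> disjoint_family_on S' (J \<union> K)"
  using assms
proof (induction K arbitrary: J S rule: finite_induct)
  case empty
  then show ?case by auto
next
  case (insert k K J S)
  \<comment> \<open>The blocked vertices: sets already chosen and reservations of the indices that
    remain pending. The reservation of \<open>k\<close> itself is left out, so its set may use
    \<open>w k\<close>.\<close>
  define B where "B = (\<Union>i\<in>J. S i) \<union> (\<Union>i\<in>K. w i)"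
  have fin: "finite B" unfolding B_def using insert by auto
  have "card (\<Union>i\<in>J. S i) \<le> (\<Sum>i\<in>J. card (S i))" by (rule card_UN_le[OF insert.prems(1)])
  also have "\<dots> = m * card J" using insert.prems(4) by simp
  finally have 1: "card (\<Union>i\<in>J. S i) \<le> m * card J" .
  have "card (\<Union>i\<in>K. w i) \<le> (\<Sum>i\<in>K. card (w i))" by (rule card_UN_le[OF insert.hyps(1)])
  also have "\<dots> \<le> (\<Sum>i\<in>K. m)" using insert.prems(5) by (intro sum_mono) auto
  finally have 2: "card (\<Union>i\<in>K. w i) \<le> m * card K" by (simp add: mult.commute)
  have "card B \<le> card (\<Union>i\<in>J. S i) + card (\<Union>i\<in>K. w i)" unfolding B_def by (rule card_Un_le)
  also have "\<dots> \<le> m * (card J + card K)" using 1 2 by (simp add: algebra_simps)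
  also have "card J + card K = card (J \<union> insert k K) - 1"
    using insert.hyps insert.prems(1,2) by (subst card_Un_disjoint) auto
  finally have cB: "card B \<le> m * (card (J \<union> insert k K) - 1)" .
  have "B \<inter> w k = {}"
    unfolding B_def using insert.prems(4,6) insert.hyps(2)
    by (fastforce simp: disjoint_family_on_def)
  then obtain T where T: "Q k T" "finite T" "card T = m" "T \<inter> B = {}"
    using insert.prems(7)[of k B] fin cB by auto
  define S1 where "S1 = S(k := T)"
  have kJ: "k \<notin> J" using insert.prems(2) by auto
  have eq: "insert k J \<union> K = J \<union> insert k K" by auto
  \<comment> \<open>The index \<open>k\<close> moves from the pending to the served ones; the union
    of the two index sets, and with it the bound on \<open>B\<close>, stays the same.\<close>
  have "\<exists>S'. (\<forall>i\<in>insert k J. S' i = S1 i) \<and> (\<forall>i\<in>K. Q i (S' i)) \<and> disjoint_family_on S' (insert k J \<union> K)"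
  proof (rule insert.IH)
    show "finite (insert k J)" using insert.prems(1) by simp
    show "insert k J \<inter> K = {}" using insert.prems(2) insert.hyps(2) by auto
    show "disjoint_family_on S1 (insert k J)"
      using insert.prems(3) T(4) kJ unfolding S1_def B_def disjoint_family_on_def by auto
    show "finite (S1 i) \<and> card (S1 i) = m \<and> S1 i \<inter> \<Union> (w ` K) = {}" if "i \<in> insert k J" for i
      using that T insert.prems(4)[of i] kJ unfolding S1_def B_def by auto
    show "finite (w i) \<and> card (w i) \<le> m" if "i \<in> K" for i using that insert.prems(5) by auto
    show "disjoint_family_on w K" using insert.prems(6) unfolding disjoint_family_on_def by auto
    show "\<exists>T. Q i T \<and> finite T \<and> card T = m \<and> T \<inter> B = {}"
      if "i \<in> K" "finite B" "B \<inter> w i = {}" "card B \<le> m * (card (insert k J \<union> K) - 1)" for i B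
      using that insert.prems(7)[of i B] unfolding eq by auto
  qed
  then obtain S' where S': "\<forall>i\<in>insert k J. S' i = S1 i" "\<forall>i\<in>K. Q i (S' i)"
      "disjoint_family_on S' (insert k J \<union> K)" by blast
  have "\<forall>i\<in>J. S' i = S i" "\<forall>i\<in>insert k K. Q i (S' i)"
    using S' T kJ unfolding S1_def by auto
  then show ?case using S'(3) unfolding eq by blast
qed

text \<open>
  The indices in a maximal set \<open>I\<close> admitting distinct high vertices are served last: their
  hypergraphs tolerate the deletion of any few vertices other than their own high vertex.
\<close>

lemma rainbow_matching_or_free:
  fixes V :: "'v set" and F :: "'a hypergraph"
  assumes V: "finite V" and m: "card (verts F) = m" "m \<ge> 1" and verts: "\<And>i. i \<in> {1..t+1} \<Longrightarrow> verts (\<H> i) = V"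
    and high_step: "\<And>i v B. \<lbrakk>i \<in> {1..t+1}; v \<in> V; high i v; B \<subseteq> V - {v}; card B \<le> m * t\<rbrakk>
           \<Longrightarrow> contains_copy F (induced (\<H> i) (V - B))"
    and low_step: "\<And>i L B. \<lbrakk>i \<in> {1..t+1}; L \<subseteq> V; card L < t; \<forall>v\<in>V - L. \<not> high i v;
              B \<subseteq> V - L; card B \<le> m * (t - card L)\<rbrakk>
           \<Longrightarrow> contains_copy F (induced (\<H> i) (V - (L \<union> B)))"
  shows "contains_rainbow_matching F (t+1) V \<H> \<or>
         (\<exists>j\<in>{1..t+1}. \<exists>L\<subseteq>V. card L = t \<and> free_of F (induced (\<H> j) (V - L)))"
proof (rule disjCI)
  assume nfree: "\<not> (\<exists>j\<in>{1..t+1}. \<exists>L\<subseteq>V. card L = t \<and> free_of F (induced (\<H> j) (V - L)))"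
  \<comment> \<open>\<open>sys I v\<close> says that \<open>v\<close> is a system of distinct high
    representatives for the indices in \<open>I\<close>.\<close>
  define sys where "sys = (\<lambda>I v. inj_on v I \<and> v ` I \<subseteq> V \<and> (\<forall>i\<in>I. high i (v i)))"
  define A where "A = {I. I \<subseteq> {1..t+1} \<and> (\<exists>v. sys I v)}"
  have "finite A" unfolding A_def by simp
  moreover have "{} \<in> A" unfolding A_def sys_def by simp
  ultimately obtain I where I: "I \<in> A" "\<And>I'. I' \<in> A \<Longrightarrow> I \<subseteq> I' \<Longrightarrow> I = I'"
    using finite_has_maximal[of A] by auto
  then obtain v where v: "inj_on v I" "v ` I \<subseteq> V" "\<And>i. i \<in> I \<Longrightarrow> high i (v i)" and It: "I \<subseteq> {1..t+1}"
    unfolding A_def sys_def by auto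
  define L where "L = v ` I"
  define J where "J = {1..t+1} - I"
  have fI: "finite I" and fJ: "finite J" using It finite_subset unfolding J_def by auto
  have cL: "card L = card I" unfolding L_def using v(1) by (rule card_image)
  have LV: "L \<subseteq> V" unfolding L_def using v(2) .
  have cJ: "card J = t + 1 - card I" unfolding J_def using It fI by (simp add: card_Diff_subset)
  \<comment> \<open>A high vertex outside \<open>L\<close> would extend the system to
    \<open>insert j I\<close>, against maximality.\<close>
  have low: "\<forall>u\<in>V - L. \<not> high j u" if "j \<in> J" for j
  proof (intro ballI notI)
    fix u assume u: "u \<in> V - L" "high j u"
    have "sys (insert j I) (v(j := u))"
      unfolding sys_def using u v that unfolding L_def J_def
      by (auto simp: inj_on_def)
    then have "insert j I \<in> A" using It that unfolding A_def J_def by auto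
    then show False using I(2)[of "insert j I"] that unfolding J_def by auto
  qed
  define Q where "Q = (\<lambda>i T. T \<subseteq> V \<and> card T = card (verts F) \<and> contains_copy F (induced (\<H> i) T))"
  have QE: "\<exists>T. Q i T \<and> T \<subseteq> V - B" if "contains_copy F (induced (\<H> i) (V - B))" for i B
    using that unfolding Q_def by (rule contains_copy_inducedE) auto
  have Qfin: "finite T \<and> card T = m" if "Q i T" for i T
    using that V m(1) finite_subset unfolding Q_def by auto
  \<comment> \<open>First pass: the indices without representative need no reservations, but their
    sets must avoid all of \<open>L\<close>.\<close>
  have "\<exists>S'. (\<forall>i\<in>{}. S' i = {}) \<and> (\<forall>i\<in>J. Q i (S' i) \<and> S' i \<inter> L = {}) \<and> disjoint_family_on S' ({} \<union> J)"
  proof (rule greedy_extension[where m = m and w = "\<lambda>_. {}"])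
    fix i and B :: "'v set" assume i: "i \<in> J" and B: "finite B" "card B \<le> m * (card ({} \<union> J) - 1)"
    have i1: "i \<in> {1..t+1}" using i unfolding J_def by auto
    have "card J \<noteq> 0" using i fJ by auto
    then have It': "card I \<le> t" using cJ by simp
    have cB: "card (B \<inter> (V - L)) \<le> m * (t - card L)"
      using B cJ cL It' card_mono[OF B(1), of "B \<inter> (V - L)"] by auto
    have "contains_copy F (induced (\<H> i) (V - (L \<union> (B \<inter> (V - L)))))"
    \<comment> \<open>If \<open>L\<close> has \<open>t\<close> elements, then \<open>i\<close> is
      the only index in \<open>J\<close>, so nothing is blocked apart from \<open>L\<close> and the
      excluded second alternative supplies the copy.\<close>
    proof (cases "card L < t")
      case True
      show ?thesis by (rule low_step[OF i1 LV True low[OF i] _ cB]) auto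
    next
      case False
      then have "card L = t" using It' cL by simp
      moreover have "B = {}" using B cJ cL \<open>card L = t\<close> by auto
      ultimately show ?thesis using nfree i1 LV unfolding free_of_def by auto
    qed
    then obtain T where "Q i T" "T \<subseteq> V - (L \<union> (B \<inter> (V - L)))" using QE by blast
    then show "\<exists>T. (Q i T \<and> T \<inter> L = {}) \<and> finite T \<and> card T = m \<and> T \<inter> B = {}"
      using Qfin[of i T] by (intro exI[of _ T]) auto
  qed (use fJ in \<open>auto simp: disjoint_family_on_def\<close>)
  then obtain S where S: "\<And>i. i \<in> J \<Longrightarrow> Q i (S i) \<and> S i \<inter> L = {}" "disjoint_family_on S J" by auto
  \<comment> \<open>Second pass: each remaining index reserves its own high vertex
    \<open>v i\<close>, so the blocked set never contains that vertex and \<open>high_step\<close>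
    applies.\<close>
  have "\<exists>S'. (\<forall>i\<in>J. S' i = S i) \<and> (\<forall>i\<in>I. Q i (S' i)) \<and> disjoint_family_on S' (J \<union> I)"
  proof (rule greedy_extension[where m = m and w = "\<lambda>i. {v i}"])
    show "J \<inter> I = {}" unfolding J_def by auto
    show "finite (S i) \<and> card (S i) = m \<and> S i \<inter> (\<Union>k\<in>I. {v k}) = {}" if "i \<in> J" for i
      using S(1)[OF that] Qfin[of i "S i"] unfolding L_def by auto
    show "disjoint_family_on (\<lambda>i. {v i}) I" using v(1) unfolding disjoint_family_on_def inj_on_def by auto
    fix i and B :: "'v set" assume i: "i \<in> I" and B: "finite B" "B \<inter> {v i} = {}" "card B \<le> m * (card (J \<union> I) - 1)"
    have "J \<union> I = {1..t+1}" using It unfolding J_def by auto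
    then have "card B \<le> m * t" using B(3) by simp
    then have cB: "card (B \<inter> V) \<le> m * t" using card_mono[OF B(1), of "B \<inter> V"] by auto
    have "contains_copy F (induced (\<H> i) (V - B \<inter> V))"
      by (rule high_step[of i "v i"]) (use i It v B(2) cB in auto)
    then obtain T where "Q i T" "T \<subseteq> V - B \<inter> V" using QE by blast
    then show "\<exists>T. Q i T \<and> finite T \<and> card T = m \<and> T \<inter> B = {}"
      using Qfin[of i T] by (intro exI[of _ T]) auto
  qed (use fI fJ S m in auto)
  then obtain S' where S': "\<And>i. i \<in> J \<Longrightarrow> S' i = S i" "\<And>i. i \<in> I \<Longrightarrow> Q i (S' i)" "disjoint_family_on S' (J \<union> I)"
    by auto
  have "J \<union> I = {1..t+1}" using It unfolding J_def by auto
  moreover have "Q i (S' i)" if "i \<in> J \<union> I" for i using that S S' by auto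
  ultimately show "contains_rainbow_matching F (t+1) V \<H>"
    using S'(3) unfolding contains_rainbow_matching_def Q_def by (intro exI[of _ S']) auto
qed

section \<open>Matching number and rainbow matchings\<close>

text \<open>A matching in \<open>H\<close> is a rainbow matching of a constant collection. This lets
  the rainbow statement for \<open>t + 1\<close> equal hypergraphs yield the statement on
  \<open>EX_matching\<close>.\<close>

lemma matching_number_ge_iff:
  fixes H :: "'b hypergraph"
  assumes H: "finite (verts H)" and F: "verts F \<noteq> {}" "finite (verts F)"
  shows "k \<le> matching_number F H \<longleftrightarrow> contains_rainbow_matching F k (verts H) (\<lambda>_. H)"
proof -
  let ?P = "\<lambda>\<C>. (\<forall>C\<in>\<C>. copy_of F H C) \<and> disjoint_family_on verts \<C>"
  let ?A = "{card \<C> | \<C>. ?P \<C>}"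
  have ne: "verts C \<noteq> {}" if "copy_of F X C" for X :: "'b hypergraph" and C
    using copy_of_card_verts[OF that] F by (auto simp: card_gt_0_iff)
  have "card \<C> \<le> card (verts H)" if "?P \<C>" for \<C>
  \<comment> \<open>One vertex chosen from each copy gives an injection into \<open>verts H\<close>,
    as the copies are disjoint and nonempty; the \<open>Max\<close> in
    \<open>matching_number\<close> is thus over a finite set.\<close>
  proof (rule card_inj_on_le[of "\<lambda>C. SOME x. x \<in> verts C"])
    have s: "(SOME x. x \<in> verts C) \<in> verts C" if "C \<in> \<C>" for C
      using ne[of H C] \<open>?P \<C>\<close> that by (simp add: some_in_eq)
    then show "inj_on (\<lambda>C. SOME x. x \<in> verts C) \<C>"
      using \<open>?P \<C>\<close> unfolding inj_on_def disjoint_family_on_def by (metis IntI empty_iff)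
    show "(\<lambda>C. SOME x. x \<in> verts C) ` \<C> \<subseteq> verts H"
      using s \<open>?P \<C>\<close> unfolding copy_of_def subhypergraph_def by blast
  qed (rule H)
  then have fA: "finite ?A" by (auto intro: finite_subset[of _ "{..card (verts H)}"])
  have "card ({}::'b hypergraph set) \<in> ?A" by (force simp: disjoint_family_on_def)
  then have "matching_number F H \<in> ?A"
    unfolding matching_number_def by (intro Max_in[OF fA]) auto
  then obtain \<C> where C: "?P \<C>" "card \<C> = matching_number F H" by auto
  show ?thesis
  proof
    assume "k \<le> matching_number F H"
    then obtain \<D> where D: "\<D> \<subseteq> \<C>" "card \<D> = k" "finite \<D>"
      using obtain_subset_with_card_n[of k \<C>] C(2) by metis
    then obtain h where h: "bij_betw h {1..k} \<D>"
      using finite_same_card_bij[of "{1..k}" \<D>] by auto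
    have hC: "copy_of F H (h i)" if "i \<in> {1..k}" for i
      using C(1) D(1) bij_betwE[OF h] that by blast
    show "contains_rainbow_matching F k (verts H) (\<lambda>_. H)"
      unfolding contains_rainbow_matching_def
    proof (intro exI[of _ "\<lambda>i. verts (h i)"] conjI ballI)
      fix i assume i: "i \<in> {1..k}"
      show "verts (h i) \<subseteq> verts H" using hC[OF i] unfolding copy_of_def subhypergraph_def by auto
      show "card (verts (h i)) = card (verts F)" using copy_of_card_verts[OF hC[OF i]] .
      show "contains_copy F (induced H (verts (h i)))"
        using copy_of_induced_verts[OF hC[OF i]] unfolding contains_copy_def by auto
    next
      show "disjoint_family_on (\<lambda>i. verts (h i)) {1..k}"
        unfolding disjoint_family_on_def
      proof (intro ballI impI)
        fix i j assume ij: "i \<in> {1..k}" "j \<in> {1..k}" "i \<noteq> j"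
        then have "h i \<noteq> h j" "h i \<in> \<C>" "h j \<in> \<C>"
          using h D(1) unfolding bij_betw_def inj_on_def by blast+
        then show "verts (h i) \<inter> verts (h j) = {}" using C(1) unfolding disjoint_family_on_def by auto
      qed
    qed
  next
    assume "contains_rainbow_matching F k (verts H) (\<lambda>_. H)"
    then obtain S where S: "\<And>i. i \<in> {1..k} \<Longrightarrow> S i \<subseteq> verts H \<and> contains_copy F (induced H (S i))"
      "disjoint_family_on S {1..k}" unfolding contains_rainbow_matching_def by blast
    then have "\<forall>i\<in>{1..k}. \<exists>C. copy_of F (induced H (S i)) C" unfolding contains_copy_def by auto
    then obtain h where h: "\<And>i. i \<in> {1..k} \<Longrightarrow> copy_of F (induced H (S i)) (h i)" by metis
    have hs: "verts (h i) \<subseteq> S i" "copy_of F H (h i)" if "i \<in> {1..k}" for i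
      using copy_of_induced[OF h[OF that]] S(1)[OF that] by auto
    have dis: "verts (h i) \<inter> verts (h j) = {}" if "i \<in> {1..k}" "j \<in> {1..k}" "i \<noteq> j" for i j
      using hs(1) that S(2) unfolding disjoint_family_on_def by blast
    have "inj_on h {1..k}"
    proof (rule inj_onI, rule ccontr)
      fix i j assume "i \<in> {1..k}" "j \<in> {1..k}" "h i = h j" "i \<noteq> j"
      then show False using dis[of i j] ne[OF h[of i]] by auto
    qed
    then have "card (h ` {1..k}) = k" by (simp add: card_image)
    moreover have "disjoint_family_on verts (h ` {1..k})"
      using dis unfolding disjoint_family_on_def by fastforce
    ultimately have "k \<in> ?A" using hs(2) by (intro CollectI exI[of _ "h ` {1..k}"]) auto
    then show "k \<le> matching_number F H" unfolding matching_number_def by (rule Max_ge[OF fA])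
  qed
qed

section \<open>Joins with a complete hypergraph\<close>

lemma join_nvertex:
  assumes "G \<in> complete_rgraphs r t" "H \<in> nvertex_rgraphs r k" "verts G \<inter> verts H = {}"
  shows "join r G H \<in> nvertex_rgraphs r (t + k)"
  using assms unfolding complete_rgraphs_def nvertex_rgraphs_def rgraph_def join_def
  by (auto simp: card_Un_disjoint)

lemma induced_join:
  assumes "G \<in> complete_rgraphs r t" "rgraph r H" "verts G \<inter> verts H = {}" "r \<ge> 1"
  shows "induced (join r G H) (verts H) = H"
proof -
  obtain T where T: "G = Hypergraph T {e. e \<subseteq> T \<and> card e = r}"
    using assms(1) unfolding complete_rgraphs_def by auto
  \<comment> \<open>An edge of \<open>G\<close> inside \<open>verts H\<close> would be empty, which
    \<open>r \<ge> 1\<close> excludes.\<close>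
  have "e \<noteq> {}" if "card e = r" for e :: "nat set" using that assms(4) by auto
  then have "edges (induced (join r G H) (verts H)) = edges H"
    using T assms(2,3) unfolding induced_def join_def rgraph_def by auto blast+
  then show ?thesis unfolding induced_def by (cases H) auto
qed

lemma edges_join_meeting:
  assumes "G \<in> complete_rgraphs r t" "rgraph r H" "verts G \<inter> verts H = {}" "r \<ge> 1"
  shows "{e \<in> edges (join r G H). e \<inter> verts G \<noteq> {}}
           = {e. e \<subseteq> verts (join r G H) \<and> card e = r \<and> e \<inter> verts G \<noteq> {}}"
proof -
  obtain T where T: "G = Hypergraph T {e. e \<subseteq> T \<and> card e = r}"
    using assms(1) unfolding complete_rgraphs_def by auto
  have H: "\<And>e. e \<in> edges H \<Longrightarrow> e \<subseteq> verts H \<and> card e = r" using assms(2) unfolding rgraph_def by auto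
  show ?thesis
  proof (intro subset_antisym subsetI)
    fix e assume "e \<in> {e \<in> edges (join r G H). e \<inter> verts G \<noteq> {}}"
    then show "e \<in> {e. e \<subseteq> verts (join r G H) \<and> card e = r \<and> e \<inter> verts G \<noteq> {}}"
      using T H[of e] unfolding join_def by auto
  next
    fix e assume "e \<in> {e. e \<subseteq> verts (join r G H) \<and> card e = r \<and> e \<inter> verts G \<noteq> {}}"
    then have e: "e \<subseteq> T \<union> verts H" "card e = r" "e \<inter> T \<noteq> {}" using T unfolding join_def by auto
    then have "e \<inter> verts H = {} \<Longrightarrow> e \<subseteq> T" by blast
    then show "e \<in> {e \<in> edges (join r G H). e \<inter> verts G \<noteq> {}}"
      using T e unfolding join_def by auto
  qed
qed

lemma card_edges_join:
  assumes "G \<in> complete_rgraphs r t" "H \<in> nvertex_rgraphs r k" "verts G \<inter> verts H = {}" "r \<ge> 1"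
  shows "card (edges (join r G H)) = ((t + k) choose r) - (k choose r) + card (edges H)"
proof -
  have J: "rgraph r (join r G H)" "card (verts (join r G H)) = t + k"
    using join_nvertex[OF assms(1-3)] unfolding nvertex_rgraphs_def by auto
  have H: "rgraph r H" using assms(2) unfolding nvertex_rgraphs_def by auto
  have G: "verts G \<subseteq> verts (join r G H)" "verts (join r G H) - verts G = verts H" "card (verts G) = t"
    using assms(1,3) unfolding join_def complete_rgraphs_def by auto
  have "finite (verts (join r G H))" using J unfolding rgraph_def by auto
  from card_subsets_meeting[OF this G(1), of r] card_edges_split[OF J(1) G(1)]
  show ?thesis
    unfolding G(2,3) J(2) induced_join[OF assms(1) H assms(3,4)] edges_join_meeting[OF assms(1) H assms(3,4)]
    by simp
qed

text \<open>Pigeonhole: a copy of \<open>F\<close> cannot live inside \<open>H\<close>, so each of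
  the \<open>t + 1\<close> disjoint sets uses one of the only \<open>t\<close> vertices of
  \<open>G\<close>.\<close>

lemma join_no_rainbow_matching:
  assumes "G \<in> complete_rgraphs r t" "rgraph r H" "verts G \<inter> verts H = {}" "r \<ge> 1" "free_of F H"
  shows "\<not> contains_rainbow_matching F (t + 1) (verts (join r G H)) (\<lambda>_. join r G H)"
proof
  assume "contains_rainbow_matching F (t + 1) (verts (join r G H)) (\<lambda>_. join r G H)"
  then obtain S where S: "\<And>i. i \<in> {1..t+1} \<Longrightarrow> S i \<subseteq> verts (join r G H) \<and> contains_copy F (induced (join r G H) (S i))"
    "disjoint_family_on S {1..t+1}" unfolding contains_rainbow_matching_def by blast
  have G: "finite (verts G)" "card (verts G) = t"
    using assms(1) unfolding complete_rgraphs_def by auto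
  have "\<exists>x. x \<in> S i \<inter> verts G" if "i \<in> {1..t+1}" for i
  proof (rule ccontr)
    assume "\<not> (\<exists>x. x \<in> S i \<inter> verts G)"
    then have "S i \<subseteq> verts H" using S(1)[OF that] unfolding join_def by auto
    then have "contains_copy F (induced (join r G H) (verts H))"
      using S(1)[OF that] contains_copy_induced_mono by blast
    then show False using induced_join[OF assms(1-4)] assms(5) unfolding free_of_def by simp
  qed
  then obtain x where x: "\<And>i. i \<in> {1..t+1} \<Longrightarrow> x i \<in> S i \<inter> verts G" by metis
  have "inj_on x {1..t+1}"
    using x S(2) unfolding inj_on_def disjoint_family_on_def by (metis IntD1 IntI empty_iff)
  then have "card {1..t+1} \<le> card (verts G)"
    by (rule card_inj_on_le) (use x G in auto)
  then show False using G by simp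
qed

text \<open>Recovers the join structure in the equality case: once every possible edge touching
  \<open>L\<close> is present, the only freedom left is the part outside \<open>L\<close>.\<close>

lemma rgraph_eq_join:
  assumes "rgraph r H" "L \<subseteq> verts H" "r \<ge> 1"
    and "{e \<in> edges H. e \<inter> L \<noteq> {}} = {e. e \<subseteq> verts H \<and> card e = r \<and> e \<inter> L \<noteq> {}}"
  shows "H = join r (Hypergraph L {e. e \<subseteq> L \<and> card e = r}) (induced H (verts H - L))"
proof -
  have mem: "e \<in> edges H \<longleftrightarrow> e \<subseteq> verts H \<and> card e = r \<and> (e \<inter> L \<noteq> {} \<or> e \<in> edges (induced H (verts H - L)))" for e
  proof -
    have "e \<in> edges H \<and> e \<inter> L \<noteq> {} \<longleftrightarrow> e \<subseteq> verts H \<and> card e = r \<and> e \<inter> L \<noteq> {}"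
      using assms(4) unfolding set_eq_iff mem_Collect_eq by (rule spec)
    moreover have "e \<in> edges H \<Longrightarrow> e \<subseteq> verts H \<and> card e = r"
      using assms(1) unfolding rgraph_def by blast
    moreover have "e \<in> edges (induced H (verts H - L)) \<longleftrightarrow> e \<in> edges H \<and> e \<subseteq> verts H - L"
      unfolding induced_def by simp
    ultimately show ?thesis by blast
  qed
  have ne: "e \<noteq> {}" if "card e = r" for e :: "'a set" using that assms(3) by auto
  have "edges H = edges (join r (Hypergraph L {e. e \<subseteq> L \<and> card e = r}) (induced H (verts H - L)))"
  proof (rule set_eqI)
    fix e
    have "e \<in> edges (induced H (verts H - L)) \<Longrightarrow> e \<subseteq> verts H - L \<and> card e = r"
      using assms(1) unfolding induced_def rgraph_def by auto
    moreover have "e \<in> edges (join r (Hypergraph L {e. e \<subseteq> L \<and> card e = r}) (induced H (verts H - L)))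
        \<longleftrightarrow> e \<subseteq> L \<and> card e = r \<or> e \<in> edges (induced H (verts H - L)) \<or>
          e \<subseteq> L \<union> (verts H - L) \<and> card e = r \<and> e \<inter> L \<noteq> {} \<and> e \<inter> (verts H - L) \<noteq> {}"
      unfolding join_def by (simp add: induced_def)
    ultimately show "e \<in> edges H \<longleftrightarrow> e \<in> edges (join r (Hypergraph L {e. e \<subseteq> L \<and> card e = r}) (induced H (verts H - L)))"
      unfolding mem[of e] using ne[of e] assms(2) by blast
  qed
  moreover have "verts H = verts (join r (Hypergraph L {e. e \<subseteq> L \<and> card e = r}) (induced H (verts H - L)))"
    using assms(2) unfolding join_def induced_def by auto
  ultimately show ?thesis using hypergraph.expand by blast
qed

section \<open>From the dichotomy to both conclusions\<close>

text \<open>The dichotomy is assumed with the weak inequality because extremal hypergraphs have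
  exactly the critical number of edges. Strictly above that number the second alternative is
  impossible by counting; at equality it forces the structure of a join.\<close>

lemma rainbow_and_extremal_of_dichotomy:
  fixes F :: "'a hypergraph"
  assumes r: "r \<ge> 1" and F: "verts F \<noteq> {}" "finite (verts F)" "edges F \<noteq> {}" and tn: "t \<le> n"
    and dichotomy: "\<And>(V :: nat set) \<H>.
      (\<forall>i\<in>{1..t + 1}. \<H> i \<in> nvertex_rgraphs r n \<and> verts (\<H> i) = V \<and>
         card (edges (\<H> i)) \<ge> (n choose r) - ((n - t) choose r) + ex_num r (n - t) F) \<Longrightarrow>
      contains_rainbow_matching F (t+1) V \<H> \<or>
         (\<exists>j\<in>{1..t+1}. \<exists>L\<subseteq>V. card L = t \<and> free_of F (induced (\<H> j) (V - L)))"
  shows "(\<forall>(V :: nat set) (\<H> :: nat \<Rightarrow> nat hypergraph).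
            (\<forall>i\<in>{1..t + 1}. \<H> i \<in> nvertex_rgraphs r n \<and> verts (\<H> i) = V \<and>
               card (edges (\<H> i)) > (n choose r) - ((n - t) choose r) + ex_num r (n - t) F) \<longrightarrow>
            contains_rainbow_matching F (t + 1) V \<H>) \<and>
         EX_matching r n (t + 1) F = join_family r (complete_rgraphs r t) (EX_graphs r (n - t) F)"
proof
  let ?g = "(n choose r) - ((n - t) choose r) + ex_num r (n - t) F"
  \<comment> \<open>If deleting \<open>L\<close> leaves an \<open>F\<close>-free hypergraph, the
    edges split into those touching \<open>L\<close> and those avoiding it, each kind with its own
    upper bound; the two bounds add up to \<open>?g\<close>.\<close>
  have ind: "card (edges H) = card (edges (induced H (verts H - L))) + card {e \<in> edges H. e \<inter> L \<noteq> {}}"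
      "card {e \<in> edges H. e \<inter> L \<noteq> {}} \<le> (n choose r) - ((n - t) choose r)"
      "card (edges (induced H (verts H - L))) \<le> ex_num r (n - t) F"
      "induced H (verts H - L) \<in> nvertex_rgraphs r (n - t)"
    if "H \<in> nvertex_rgraphs r n" "L \<subseteq> verts H" "card L = t" "free_of F (induced H (verts H - L))" for H L
  proof -
    have H: "rgraph r H" "card (verts H) = n" using that(1) unfolding nvertex_rgraphs_def by auto
    then have "finite (verts H)" unfolding rgraph_def by simp
    then have "card (verts H - L) = n - t"
      using that(2,3) H(2) by (simp add: card_Diff_subset finite_subset)
    then show *: "induced H (verts H - L) \<in> nvertex_rgraphs r (n - t)"
      using induced_nvertex[OF that(1)] by auto
    show "card (edges (induced H (verts H - L))) \<le> ex_num r (n - t) F"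
      by (rule card_edges_le_ex_num[OF * that(4)])
    show "card (edges H) = card (edges (induced H (verts H - L))) + card {e \<in> edges H. e \<inter> L \<noteq> {}}"
      by (rule card_edges_split[OF H(1) that(2)])
    show "card {e \<in> edges H. e \<inter> L \<noteq> {}} \<le> (n choose r) - ((n - t) choose r)"
      using card_edges_meeting_le[OF H(1) that(2)] H(2) that(3) by simp
  qed
  have rainbow: "contains_rainbow_matching F (t + 1) V \<H>"
    if "\<forall>i\<in>{1..t + 1}. \<H> i \<in> nvertex_rgraphs r n \<and> verts (\<H> i) = V \<and> card (edges (\<H> i)) > ?g"
    for V :: "nat set" and \<H>
  proof (rule ccontr)
    assume no: "\<not> contains_rainbow_matching F (t + 1) V \<H>"
    have "\<forall>i\<in>{1..t + 1}. \<H> i \<in> nvertex_rgraphs r n \<and> verts (\<H> i) = V \<and> card (edges (\<H> i)) \<ge> ?g"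
      using that by (meson less_imp_le)
    from dichotomy[OF this] no
    obtain j L where j: "j \<in> {1..t+1}" "L \<subseteq> V" "card L = t" "free_of F (induced (\<H> j) (V - L))"
      by blast
    have Hj: "\<H> j \<in> nvertex_rgraphs r n" "verts (\<H> j) = V" "card (edges (\<H> j)) > ?g"
      using that j(1) by blast+
    show False using ind(1-3)[OF Hj(1), of L] j(2-4) Hj(2,3) by simp
  qed
  then show "\<forall>(V :: nat set) (\<H> :: nat \<Rightarrow> nat hypergraph).
            (\<forall>i\<in>{1..t + 1}. \<H> i \<in> nvertex_rgraphs r n \<and> verts (\<H> i) = V \<and> card (edges (\<H> i)) > ?g) \<longrightarrow>
            contains_rainbow_matching F (t + 1) V \<H>" by blast
  have mn: "matching_number F H < t + 1 \<longleftrightarrow> \<not> contains_rainbow_matching F (t + 1) (verts H) (\<lambda>_. H)"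
    if "H \<in> nvertex_rgraphs r n" for H
    using matching_number_ge_iff[of H F "t + 1"] that F unfolding nvertex_rgraphs_def rgraph_def by auto
  have upper: "card (edges H) \<le> ?g" if "H \<in> nvertex_rgraphs r n" "matching_number F H < t + 1" for H
    using rainbow[of "\<lambda>_. H" "verts H"] that mn[OF that(1)] by fastforce
  have joins: "join r G H \<in> nvertex_rgraphs r n \<and> matching_number F (join r G H) < t + 1
      \<and> card (edges (join r G H)) = ?g"
    if "G \<in> complete_rgraphs r t" "H \<in> EX_graphs r (n - t) F" "verts G \<inter> verts H = {}" for G H
  proof -
    have H: "H \<in> nvertex_rgraphs r (n - t)" "rgraph r H" "free_of F H" "card (edges H) = ex_num r (n - t) F"
      using that(2) unfolding EX_graphs_def nvertex_rgraphs_def by auto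
    have J: "join r G H \<in> nvertex_rgraphs r n" using join_nvertex[OF that(1) H(1) that(3)] tn by simp
    show ?thesis
      using J mn[OF J] join_no_rainbow_matching[OF that(1) H(2) that(3) r H(3)]
        card_edges_join[OF that(1) H(1) that(3) r] H(4) tn by simp
  qed
  show "EX_matching r n (t + 1) F = join_family r (complete_rgraphs r t) (EX_graphs r (n - t) F)"
  proof
    show "join_family r (complete_rgraphs r t) (EX_graphs r (n - t) F) \<subseteq> EX_matching r n (t + 1) F"
    proof
      fix X assume "X \<in> join_family r (complete_rgraphs r t) (EX_graphs r (n - t) F)"
      then obtain G H where GH: "X = join r G H" "G \<in> complete_rgraphs r t"
          "H \<in> EX_graphs r (n - t) F" "verts G \<inter> verts H = {}" unfolding join_family_def by auto
      show "X \<in> EX_matching r n (t + 1) F"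
        unfolding EX_matching_def GH(1) using joins[OF GH(2-4)] upper by auto
    qed
    show "EX_matching r n (t + 1) F \<subseteq> join_family r (complete_rgraphs r t) (EX_graphs r (n - t) F)"
    proof
      fix H assume "H \<in> EX_matching r n (t + 1) F"
      then have H: "H \<in> nvertex_rgraphs r n" "matching_number F H < t + 1"
          "\<And>H'. \<lbrakk>H' \<in> nvertex_rgraphs r n; matching_number F H' < t + 1\<rbrakk> \<Longrightarrow> card (edges H') \<le> card (edges H)"
        unfolding EX_matching_def by auto
      have rH: "rgraph r H" "card (verts H) = n" using H(1) unfolding nvertex_rgraphs_def by auto
      obtain E where E: "E \<in> EX_graphs r (n - t) F" using EX_graphs_nonempty[OF F(3)] by blast
      then have "finite (verts E)" unfolding EX_graphs_def nvertex_rgraphs_def rgraph_def by auto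
      \<comment> \<open>\<open>verts E\<close> is a finite set of naturals, so \<open>t\<close>
        fresh vertices exist. The resulting join shows that the extremal number is at least
        \<open>?g\<close>.\<close>
      then obtain T where T: "T \<subseteq> - verts E" "finite T" "card T = t"
        using infinite_arbitrarily_large[of "- verts E" t] by (auto simp: Compl_eq_Diff_UNIV)
      then have "?g \<le> card (edges H)"
        using joins[of "Hypergraph T {e. e \<subseteq> T \<and> card e = r}" E] E H(3)
        unfolding complete_rgraphs_def by fastforce
      then obtain L where L: "L \<subseteq> verts H" "card L = t" "free_of F (induced H (verts H - L))"
        using dichotomy[of "\<lambda>_. H" "verts H"] H(1,2) mn[OF H(1)] by auto
      note i = ind[OF H(1) L]
      \<comment> \<open>Two quantities whose sum reaches the sum of their upper bounds must both
        attain them.\<close>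
      have eq: "card {e \<in> edges H. e \<inter> L \<noteq> {}} = (n choose r) - ((n - t) choose r)"
          "card (edges (induced H (verts H - L))) = ex_num r (n - t) F"
        using i(1-3) \<open>?g \<le> card (edges H)\<close> by auto
      have fV: "finite (verts H)" using rH unfolding rgraph_def by auto
      have "{e \<in> edges H. e \<inter> L \<noteq> {}} = {e. e \<subseteq> verts H \<and> card e = r \<and> e \<inter> L \<noteq> {}}"
      proof (rule card_subset_eq)
        show "finite {e. e \<subseteq> verts H \<and> card e = r \<and> e \<inter> L \<noteq> {}}" using fV by auto
        show "{e \<in> edges H. e \<inter> L \<noteq> {}} \<subseteq> {e. e \<subseteq> verts H \<and> card e = r \<and> e \<inter> L \<noteq> {}}"
          using rH(1) unfolding rgraph_def by auto
        show "card {e \<in> edges H. e \<inter> L \<noteq> {}} = card {e. e \<subseteq> verts H \<and> card e = r \<and> e \<inter> L \<noteq> {}}"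
          using eq(1) card_subsets_meeting[OF fV L(1), of r] rH(2) L(2) by simp
      qed
      then have "H = join r (Hypergraph L {e. e \<subseteq> L \<and> card e = r}) (induced H (verts H - L))"
        by (rule rgraph_eq_join[OF rH(1) L(1) r])
      moreover have "Hypergraph L {e. e \<subseteq> L \<and> card e = r} \<in> complete_rgraphs r t"
        using L finite_subset[OF L(1) fV] unfolding complete_rgraphs_def by auto
      moreover have "induced H (verts H - L) \<in> EX_graphs r (n - t) F"
        using eq(2) L(3) i(4) unfolding EX_graphs_def by auto
      moreover have "L \<inter> verts (induced H (verts H - L)) = {}" unfolding induced_def by auto
      ultimately show "H \<in> join_family r (complete_rgraphs r t) (EX_graphs r (n - t) F)"
        unfolding join_family_def by (metis (mono_tags, lifting) mem_Collect_eq hypergraph.sel(1))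
    qed
  qed
qed

section \<open>Turan density\<close>

lemma ex_num_le_binomial:
  assumes "edges F \<noteq> {}"
  shows "ex_num r n F \<le> n choose r"
proof -
  obtain H where H: "H \<in> EX_graphs r n F" using EX_graphs_nonempty[OF assms] by blast
  then have "rgraph r H" "card (verts H) = n" "card (edges H) = ex_num r n F"
    unfolding EX_graphs_def nvertex_rgraphs_def by auto
  then show ?thesis using rgraph_card_edges_le[of r H] by simp
qed

text \<open>Deleting \<open>v\<close> from an extremal hypergraph leaves an \<open>F\<close>-free
  one and costs at most \<open>degree H v\<close> edges. Summing over all \<open>v\<close> and using
  \<open>handshake\<close> gives the claim, written additively to avoid subtraction in
  \<open>nat\<close>.\<close>

lemma ex_num_averaging:
  assumes "edges F \<noteq> {}"
  shows "Suc n * ex_num r (Suc n) F \<le> Suc n * ex_num r n F + r * ex_num r (Suc n) F"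
proof -
  obtain H where "H \<in> EX_graphs r (Suc n) F" using EX_graphs_nonempty[OF assms] by blast
  then have Hn: "H \<in> nvertex_rgraphs r (Suc n)" and H: "rgraph r H" "card (verts H) = Suc n"
      and free: "free_of F H" and e: "card (edges H) = ex_num r (Suc n) F"
    unfolding EX_graphs_def nvertex_rgraphs_def by auto
  have fV: "finite (verts H)" using H unfolding rgraph_def by simp
  have "card (edges H) \<le> ex_num r n F + degree H v" if v: "v \<in> verts H" for v
  proof -
    let ?G = "induced H (verts H - {v})"
    have "?G \<in> nvertex_rgraphs r n"
      by (rule induced_nvertex[OF Hn]) (use fV v H(2) in auto)
    moreover have "free_of F ?G"
      using free contains_copy_mono[of F ?G H] unfolding free_of_def by (auto simp: induced_def)
    ultimately have "card (edges ?G) \<le> ex_num r n F" by (rule card_edges_le_ex_num)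
    then show ?thesis
      using card_edges_split[OF H(1), of "{v}"] card_edges_meeting_le_sum_degree[OF H(1), of "{v}"] v
      by simp
  qed
  then have "(\<Sum>v\<in>verts H. card (edges H)) \<le> (\<Sum>v\<in>verts H. ex_num r n F + degree H v)"
    by (rule sum_mono)
  then show ?thesis using handshake[OF H(1)] H(2) e by (simp add: sum.distrib)
qed

text \<open>The Katona-Nemetz-Simonovits monotonicity: the averaging bound combined with
  \<open>(Suc n - r) * (Suc n choose r) = Suc n * (n choose r)\<close>. The assumption
  \<open>r \<le> n\<close> makes \<open>Suc n - r\<close> positive, so that it can be
  cancelled.\<close>

lemma ex_density_antimono:
  assumes "edges F \<noteq> {}" "r \<le> n"
  shows "real (ex_num r (Suc n) F) / real (Suc n choose r) \<le> real (ex_num r n F) / real (n choose r)"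
proof -
  have pos: "0 < Suc n choose r" "0 < n choose r" using assms(2) by auto
  have "(Suc n - r) * (Suc n choose r) = Suc n * (n choose r)"
    using binomial_absorb_comp[of "Suc n" r] by simp
  then have 1: "real (Suc n) * real (n choose r) = (real (Suc n) - real r) * real (Suc n choose r)"
    using assms(2) by (metis le_SucI of_nat_diff of_nat_mult)
  have "real (Suc n * ex_num r (Suc n) F) \<le> real (Suc n * ex_num r n F + r * ex_num r (Suc n) F)"
    using ex_num_averaging[OF assms(1)] by (rule of_nat_mono)
  then have 2: "(real (Suc n) - real r) * real (ex_num r (Suc n) F) \<le> real (Suc n) * real (ex_num r n F)"
    by (simp add: algebra_simps)
  have "(real (Suc n) - real r) * (real (ex_num r (Suc n) F) * real (n choose r))
      \<le> real (Suc n) * real (ex_num r n F) * real (n choose r)"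
    using mult_right_mono[OF 2, of "real (n choose r)"] by (simp add: algebra_simps)
  also have "\<dots> = (real (Suc n) - real r) * (real (ex_num r n F) * real (Suc n choose r))"
    using arg_cong[OF 1, of "\<lambda>x. real (ex_num r n F) * x"] by (simp only: mult_ac)
  finally have "real (ex_num r (Suc n) F) * real (n choose r) \<le> real (ex_num r n F) * real (Suc n choose r)"
    using assms(2) by (simp add: mult_le_cancel_left)
  then show ?thesis using pos by (simp add: frac_le_eq divide_simps mult_ac)
qed

text \<open>A nonincreasing sequence bounded below by 0 converges to a limit that lies below all its
  terms. So the \<open>lim\<close> in \<open>turan_density\<close> is a genuine limit, and it bounds
  \<open>ex_num\<close> from below for every \<open>n\<close>, not only for large ones.\<close>

lemma turan_density_limit:
  assumes "edges F \<noteq> {}"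
  shows "(\<lambda>n. real (ex_num r n F) / real (n choose r)) \<longlonglongrightarrow> turan_density r F"
    and "turan_density r F * real (n choose r) \<le> real (ex_num r n F)"
proof -
  let ?u = "\<lambda>n. real (ex_num r n F) / real (n choose r)"
  have "decseq (\<lambda>n. ?u (n + r))"
    using ex_density_antimono[OF assms] by (intro decseq_SucI) simp
  then obtain l where l: "(\<lambda>n. ?u (n + r)) \<longlonglongrightarrow> l" "\<And>i. l \<le> ?u (i + r)"
    using decseq_convergent[of "\<lambda>n. ?u (n + r)" 0] by auto
  have lim: "?u \<longlonglongrightarrow> l" using LIMSEQ_offset[OF l(1)] .
  then have td: "turan_density r F = l" unfolding turan_density_def by (rule limI)
  show "?u \<longlonglongrightarrow> turan_density r F" using lim td by simp
  show "turan_density r F * real (n choose r) \<le> real (ex_num r n F)"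
  proof (cases "r \<le> n")
    case True
    then have "turan_density r F \<le> ?u n" using l(2)[of "n - r"] td by simp
    then show ?thesis using True by (simp add: pos_le_divide_eq)
  next
    case False
    then show ?thesis by (simp add: binomial_eq_0)
  qed
qed

lemma turan_density_le_1:
  assumes "edges F \<noteq> {}"
  shows "turan_density r F \<le> 1"
  using turan_density_limit(2)[OF assms, of r r] ex_num_le_binomial[OF assms, of r r] by simp

text \<open>
  Without edges, \<open>F\<close> is contained in every large graph and \<^const>\<open>ex_num\<close> is the
  unspecified constant \<open>Max {}\<close>.
\<close>

lemma nondegenerate_edges_nonempty:
  assumes "nondegenerate r F" "r \<ge> 1" "finite (verts F)"
  shows "edges F \<noteq> {}"
proof
  assume F: "edges F = {}"
  have ex: "ex_num r n F = Max {}" if n: "card (verts F) \<le> n" for n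
  proof -
    have none: "\<not> free_of F H" if "H \<in> nvertex_rgraphs r n" for H
      using contains_copy_edgeless[OF F assms(3), of H] that n
      unfolding nvertex_rgraphs_def rgraph_def free_of_def by auto
    have "{card (edges H) | H. H \<in> nvertex_rgraphs r n \<and> free_of F H} = {}" using none by auto
    then show ?thesis unfolding ex_num_def by (rule arg_cong)
  qed
  let ?K = "real (Max {} :: nat)"
  have lim: "(\<lambda>n. ?K * real r / real n) \<longlonglongrightarrow> 0" by (rule lim_const_over_n)
  have up: "\<forall>\<^sub>F n in sequentially.
      real (ex_num r n F) / real (n choose r) \<le> ?K * real r / real n"
    using eventually_ge_at_top[of "r + card (verts F) + 1"]
  proof eventually_elim
    case (elim n)
    have "n > 0" "r \<le> n" "card (verts F) \<le> n" using elim by auto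
    \<comment> \<open>Absorption gives \<open>n \<le> r * (n choose r)\<close>, so a constant
      numerator makes the density at most a constant over \<open>n\<close>.\<close>
    have "1 \<le> (n - 1) choose (r - 1)" using elim by (simp add: Suc_le_eq)
    then have "n * 1 \<le> n * ((n - 1) choose (r - 1))" by (intro mult_le_mono) auto
    also have "\<dots> = r * (n choose r)" using times_binomial_minus1_eq[of r n] assms(2) by simp
    finally have "real n \<le> real r * real (n choose r)" by (metis mult.right_neutral of_nat_le_iff of_nat_mult)
    then have "?K * real n \<le> ?K * (real r * real (n choose r))" by (intro mult_left_mono) auto
    moreover have "0 < n choose r" using elim by simp
    ultimately show ?case using ex[of n] elim by (simp add: divide_simps mult_ac)
  qed
  have "(\<lambda>n. real (ex_num r n F) / real (n choose r)) \<longlonglongrightarrow> 0"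
    by (rule tendsto_sandwich[OF _ up tendsto_const lim]) simp
  then have "turan_density r F = 0" unfolding turan_density_def by (rule limI)
  then show False using assms(1) unfolding nondegenerate_def by simp
qed

section \<open>Average degrees and binomial estimates\<close>

lemma binomial_minus1_eq:
  assumes "k \<ge> 1" "n \<ge> 1"
  shows "real ((n - 1) choose (k - 1)) = real k / real n * real (n choose k)"
proof -
  have "real k * real (n choose k) = real n * real ((n - 1) choose (k - 1))"
    using times_binomial_minus1_eq[of k n] assms by (metis Suc_le_eq One_nat_def of_nat_mult)
  then show ?thesis using assms by (simp add: field_simps)
qed

text \<open>The factor \<open>r / n\<close> that turns edge counts into average degrees turns
  \<open>n choose r\<close> into \<open>(n - 1) choose (r - 1)\<close>.\<close>

lemma d_ex_ge:
  assumes "edges F \<noteq> {}" "r \<ge> 1" "n \<ge> 1"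
  shows "turan_density r F * real ((n - 1) choose (r - 1)) \<le> d_ex r n F"
proof -
  have "turan_density r F * real ((n - 1) choose (r - 1))
      = real r / real n * (turan_density r F * real (n choose r))"
    using binomial_minus1_eq[OF assms(2,3)] by simp
  also have "\<dots> \<le> real r / real n * real (ex_num r n F)"
    using turan_density_limit(2)[OF assms(1)] by (intro mult_left_mono) auto
  finally show ?thesis unfolding d_ex_def by simp
qed

lemma eventually_d_ex_le:
  assumes "edges F \<noteq> {}" "r \<ge> 1" "\<epsilon> > 0"
  shows "\<forall>\<^sub>F n in sequentially. d_ex r n F \<le> (turan_density r F + \<epsilon>) * real ((n - 1) choose (r - 1))"
proof -
  have "\<forall>\<^sub>F n in sequentially. real (ex_num r n F) / real (n choose r) < turan_density r F + \<epsilon>"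
    using turan_density_limit(1)[OF assms(1)] assms(3) by (intro order_tendstoD) auto
  then show ?thesis using eventually_ge_at_top[of r]
  proof eventually_elim
    case (elim n)
    have n: "n \<ge> 1" "0 < n choose r" using elim assms(2) by auto
    then have "real (ex_num r n F) \<le> (turan_density r F + \<epsilon>) * real (n choose r)"
      using elim by (simp add: pos_divide_less_eq)
    then have "real r / real n * real (ex_num r n F) \<le> real r / real n * ((turan_density r F + \<epsilon>) * real (n choose r))"
      by (intro mult_left_mono) auto
    then show ?case unfolding d_ex_def binomial_minus1_eq[OF assms(2) n(1)] by (simp add: mult_ac)
  qed
qed

text \<open>By Pascal's rule, lowering the upper index by one costs at most
  \<open>(n - 1) choose (k - 1)\<close>, which is the fraction \<open>k / n\<close> of
  \<open>n choose k\<close>.\<close>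

lemma binomial_diff_ge:
  assumes "n \<ge> 1"
  shows "(1 - real x * real k / real n) * real (n choose k) \<le> real ((n - x) choose k)"
proof (cases "k = 0")
  case True
  then show ?thesis by simp
next
  case False
  have "real (n choose k) - real x * real ((n - 1) choose (k - 1)) \<le> real ((n - x) choose k)"
  proof (induction x)
    case (Suc x)
    show ?case
    proof (cases "n - x")
      \<comment> \<open>Subtraction in \<open>nat\<close> has already reached 0, so a further
        decrement changes nothing.\<close>
      case 0
      then show ?thesis using Suc by (simp add: algebra_simps)
    next
      case (Suc j)
      have "real (Suc j choose k) = real (j choose (k - 1)) + real (j choose k)"
        using False by (cases k) auto
      moreover have "real (j choose (k - 1)) \<le> real ((n - 1) choose (k - 1))"
        using Suc by (intro of_nat_mono binomial_right_mono) auto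
      moreover have "n - Suc x = j" using Suc by simp
      ultimately show ?thesis using Suc.IH Suc by (simp add: algebra_simps)
    qed
  qed simp
  then show ?thesis using binomial_minus1_eq[of k n] False assms by (simp add: algebra_simps)
qed

lemma binomial_increment_ge:
  assumes "r \<ge> 1"
  shows "x * (b choose (r - 1)) \<le> ((b + x) choose r) - (b choose r)"
proof -
  have "(b choose r) + x * (b choose (r - 1)) \<le> (b + x) choose r"
  proof (induction x)
    case (Suc x)
    have "Suc (b + x) choose r = ((b + x) choose (r - 1)) + ((b + x) choose r)"
      using assms by (cases r) auto
    moreover have "b choose (r - 1) \<le> (b + x) choose (r - 1)" by (intro binomial_right_mono) auto
    ultimately show ?case using Suc by simp
  qed simp
  then show ?thesis by linarith
qed

section \<open>Estimates for fixed \<open>n\<close> and \<open>t\<close>\<close>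

text \<open>The case \<open>t = 0\<close> is trivial and excluded here; \<open>t \<ge> 1\<close> forces \<open>p < 1\<close>.\<close>

locale matching_setup =
  fixes F :: "'a hypergraph" and f :: "nat \<Rightarrow> real" and r m n t N :: nat and p :: real
  assumes r2: "2 \<le> r" and rm: "r \<le> m"
    and edges_F: "edges F \<noteq> {}" and card_F: "card (verts F) = m"
    and p_def: "p = turan_density r F" and p1: "p < 1" and p0: "0 < p"
    and mono_f: "mono f"
    and smooth: "\<And>k. N \<le> k \<Longrightarrow>
      \<bar>delta_ex r k F - d_ex r (k - 1) F\<bar> \<le> (1 - p) / (8 * real m) * real (k choose (r - 1))"
    and bounded: "\<And>k H. \<lbrakk>N \<le> k; H \<in> nvertex_rgraphs r k; free_of F H; avg_degree H \<ge> d_ex r k F - f k\<rbrakk>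
      \<Longrightarrow> real (max_degree H) \<le> d_ex r k F + (1 - p) / (4 * real m) * real (k choose (r - 1))"
    and d_upper: "\<And>k. N \<le> k \<Longrightarrow>
      d_ex r k F \<le> (p + (1 - p) / (16 * real m)) * real ((k - 1) choose (r - 1))"
    and n_large: "2 * N + 2 * r + 2 \<le> n" "64 * real r * real m / (1 - p) \<le> real n"
    and t_pos: "1 \<le> t" and t_small: "real t \<le> (1 - p) / (64 * real r * (real m)^2) * real n"
    and f_large: "2 * exp 1 * real m * real t * real ((n - 2 * m * t) choose (r - 2)) \<le> f (n - 2 * m * t)"
begin

text \<open>The degree from which a vertex counts as high. The margin
  \<open>(1 - p) / (2 * m)\<close> must be small enough that \<open>m\<close> vertices below it cost
  less than \<open>low_count\<close> gains, and large enough to exceed the bound on the maximum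
  degree in \<open>high_step\<close>.\<close>

definition "threshold = p * real ((n - 1) choose (r - 1)) + (1 - p) / (2 * real m) * real (n choose (r - 1))"

lemma m2: "2 \<le> m" using r2 rm by simp

lemma n_pos: "n > 0" "n \<ge> 1" "real n > 0" using n_large by auto

text \<open>By \<open>binomial_diff_ge\<close>, the left side bounds the fraction that a binomial
  with lower index at most \<open>r\<close> loses when \<open>m * t\<close> vertices are
  deleted.\<close>

lemma mt_r: "real m * real t * real r / real n \<le> (1 - p) / (64 * real m)"
proof -
  have pos: "real m > 0" "real r > 0" using m2 r2 by auto
  have "real m * real t * real r / real n
      \<le> real m * ((1 - p) / (64 * real r * (real m)^2) * real n) * real r / real n"
    using t_small pos n_pos by (intro divide_right_mono mult_right_mono mult_left_mono) auto
  also have "\<dots> = (1 - p) / (64 * real m)"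
    using pos n_pos by (simp add: field_simps power2_eq_square)
  finally show ?thesis .
qed

lemma mt_r_const: "real m * real t * real r / real n \<le> 1 / 128"
proof -
  have "(1 - p) / (64 * real m) \<le> 1 / 128"
    using m2 p0 p1 by (simp add: field_simps)
  then show ?thesis using mt_r by linarith
qed

lemma mt_le: "256 * (m * t) \<le> n"
proof -
  have "real m * real t * 2 / real n \<le> real m * real t * real r / real n"
    using r2 by (intro divide_right_mono mult_left_mono) auto
  then have "real m * real t * 2 / real n \<le> 1 / 128" using mt_r_const by linarith
  then have "256 * (real m * real t) \<le> real n" using n_pos by (simp add: field_simps)
  then show ?thesis by (metis of_nat_le_iff of_nat_mult of_nat_numeral)
qed

lemma C_pos: "real (n choose (r - 1)) > 0"
  using n_large by simp

lemma C_mono: "k \<le> n \<Longrightarrow> real (k choose j) \<le> real (n choose j)"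
  by (intro of_nat_mono binomial_right_mono)

text \<open>Half of the allowed loss \<open>(1 - p) / (32 * m)\<close> is for the
  \<open>m * t\<close> deleted vertices, by \<open>mt_r\<close>; the other half is for the extra 1,
  by the lower bound on \<open>n\<close>.\<close>

lemma binomial_after_deletion:
  "(1 - (1 - p) / (32 * real m)) * real (n choose (r - 1)) \<le> real ((n - (m * t + 1)) choose (r - 1))"
proof -
  have pos: "real m > 0" using m2 by auto
  have "real (m * t + 1) * real (r - 1) / real n \<le> real (m * t + 1) * real r / real n"
    by (intro divide_right_mono mult_left_mono) auto
  also have "\<dots> = real m * real t * real r / real n + real r / real n"
    by (simp add: add_divide_distrib algebra_simps)
  also have "real r / real n \<le> (1 - p) / (64 * real m)"
    using n_large(2) n_pos pos p1 by (simp add: field_simps)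
  finally have "real (m * t + 1) * real (r - 1) / real n \<le> (1 - p) / (32 * real m)"
    using mt_r by simp
  then have "(1 - (1 - p) / (32 * real m)) * real (n choose (r - 1))
      \<le> (1 - real (m * t + 1) * real (r - 1) / real n) * real (n choose (r - 1))"
    using C_pos by (intro mult_right_mono) auto
  also have "\<dots> \<le> real ((n - (m * t + 1)) choose (r - 1))" by (rule binomial_diff_ge[OF n_pos(2)])
  finally show ?thesis .
qed

text \<open>Smoothness, telescoped: each new vertex adds at least the preceding \<open>d_ex\<close>
  minus the error term, and \<open>d_ex_ge\<close> bounds \<open>d_ex\<close> from below through
  \<open>p\<close>.\<close>

lemma ex_num_increment:
  assumes "N \<le> b" "1 \<le> b" "b + x \<le> n"
  shows "real (ex_num r b F)
      + real x * (p * real ((b - 1) choose (r - 1)) - (1 - p) / (8 * real m) * real (n choose (r - 1)))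
    \<le> real (ex_num r (b + x) F)"
  using assms(3)
proof (induction x)
  case (Suc x)
  define Z where "Z = p * real ((b - 1) choose (r - 1)) - (1 - p) / (8 * real m) * real (n choose (r - 1))"
  have "- (delta_ex r (b + Suc x) F - d_ex r (b + x) F)
      \<le> (1 - p) / (8 * real m) * real ((b + Suc x) choose (r - 1))"
    using smooth[of "b + Suc x"] assms(1) by simp
  also have "\<dots> \<le> (1 - p) / (8 * real m) * real (n choose (r - 1))"
    using Suc.prems p1 by (intro mult_left_mono C_mono) auto
  finally have 1: "d_ex r (b + x) F - (1 - p) / (8 * real m) * real (n choose (r - 1))
      \<le> real (ex_num r (b + Suc x) F) - real (ex_num r (b + x) F)"
    unfolding delta_ex_def by simp
  have "p * real ((b - 1) choose (r - 1)) \<le> p * real ((b + x - 1) choose (r - 1))"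
    using p0 by (intro mult_left_mono of_nat_mono binomial_right_mono) auto
  also have "\<dots> \<le> d_ex r (b + x) F"
    unfolding p_def by (rule d_ex_ge[OF edges_F]) (use r2 assms in auto)
  finally have "Z \<le> real (ex_num r (b + Suc x) F) - real (ex_num r (b + x) F)"
    using 1 unfolding Z_def by linarith
  moreover have "real (ex_num r b F) + real x * Z \<le> real (ex_num r (b + x) F)"
    using Suc unfolding Z_def by simp
  moreover have "real (Suc x) * Z = real x * Z + Z" by (simp add: algebra_simps)
  ultimately show ?case unfolding Z_def[symmetric] by linarith
qed simp

text \<open>Between the two extremal numbers lie \<open>(m - 1) * (t - s)\<close> vertices, each
  worth about \<open>p\<close> times a binomial by smoothness. The difference of binomials supplies
  \<open>t - s\<close> further increments of full weight 1; this surplus of \<open>1 - p\<close> per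
  index drives \<open>low_count\<close>.\<close>

lemma ex_num_deletion:
  assumes "s \<le> t"
  shows "real (ex_num r (n - s - m * (t - s)) F)
      + real (t - s) * ((real m - 1) * (p * real ((n - (m * t + 1)) choose (r - 1))
          - (1 - p) / (8 * real m) * real (n choose (r - 1))))
      + real (t - s) * real ((n - (m * t + 1)) choose (r - 1))
    \<le> real (((n - s) choose r) - ((n - t) choose r)) + real (ex_num r (n - t) F)"
proof -
  define b where "b = n - s - m * (t - s)"
  \<comment> \<open>At most \<open>m * t\<close> vertices are missing at any stage, so
    \<open>n - (m * t + 1)\<close> serves as a uniform lower index for all binomials.\<close>
  have "1 * s + m * (t - s) \<le> m * s + m * (t - s)" using m2 by (intro add_mono mult_right_mono) auto
  also have "\<dots> = m * t" using assms by (metis add_mult_distrib2 le_add_diff_inverse)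
  finally have sm: "s + m * (t - s) \<le> m * t" by simp
  have b: "n - m * t \<le> b" "N \<le> b" "1 \<le> b" unfolding b_def using sm mt_le n_large by linarith+
  have tm: "t \<le> m * t" using m2 by simp
  have mm: "m * (t - s) = (m - 1) * (t - s) + (t - s)" using m2 by (cases m) auto
  have bn: "b + (m - 1) * (t - s) = n - t"
    unfolding b_def mm using sm mt_le assms mm by linarith
  have mono: "real ((n - (m * t + 1)) choose (r - 1)) \<le> real ((b - 1) choose (r - 1))"
    using b by (intro of_nat_mono binomial_right_mono) auto
  have m1: "real (m - 1) = real m - 1" using m2 by (simp add: of_nat_diff)
  have "real ((m - 1) * (t - s)) * (p * real ((n - (m * t + 1)) choose (r - 1))
          - (1 - p) / (8 * real m) * real (n choose (r - 1)))
      \<le> real ((m - 1) * (t - s)) * (p * real ((b - 1) choose (r - 1))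
          - (1 - p) / (8 * real m) * real (n choose (r - 1)))"
    using mono p0 by (intro mult_left_mono diff_right_mono) auto
  then have 1: "real (ex_num r b F) + real ((m - 1) * (t - s)) * (p * real ((n - (m * t + 1)) choose (r - 1))
          - (1 - p) / (8 * real m) * real (n choose (r - 1))) \<le> real (ex_num r (n - t) F)"
    using ex_num_increment[OF b(2,3), of "(m - 1) * (t - s)"] unfolding bn by simp
  have "n - t + (t - s) = n - s" using assms mt_le tm by linarith
  then have "(t - s) * ((n - t) choose (r - 1)) \<le> ((n - s) choose r) - ((n - t) choose r)"
    using binomial_increment_ge[of r "t - s" "n - t"] r2 by simp
  then have 2: "real (t - s) * real ((n - t) choose (r - 1)) \<le> real (((n - s) choose r) - ((n - t) choose r))"
    by (metis of_nat_le_iff of_nat_mult)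
  have "real ((n - (m * t + 1)) choose (r - 1)) \<le> real ((n - t) choose (r - 1))"
    using tm by (intro of_nat_mono binomial_right_mono diff_le_mono2) linarith
  then have "real (t - s) * real ((n - (m * t + 1)) choose (r - 1)) \<le> real (t - s) * real ((n - t) choose (r - 1))"
    by (intro mult_left_mono) auto
  moreover have "real ((m - 1) * (t - s)) = real (t - s) * (real m - 1)" using m1 by simp
  ultimately show ?thesis using 1 2 unfolding b_def[symmetric] by (simp only: mult.assoc)
qed

text \<open>With \<open>C = n choose (r - 1)\<close>, each of the \<open>t - s\<close> indices gains
  about \<open>(1 + (m - 1) * p) * C\<close>, while \<open>m\<close> vertices below the threshold
  cost at most \<open>(m * p + (1 - p) / 2) * C\<close>. The difference
  \<open>(1 - p) / 2 * C\<close> absorbs the errors \<open>(1 - p) / 32 * C\<close> from shrinking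
  binomials and \<open>(1 - p) / 8 * C\<close> from smoothness.\<close>

lemma low_count:
  assumes "s < t"
  shows "real (ex_num r (n - s - m * (t - s)) F)
    < real (((n - s) choose r) - ((n - t) choose r)) + real (ex_num r (n - t) F)
      - real (m * (t - s)) * threshold"
proof -
  define C where "C = real (n choose (r - 1))"
  define P where "P = real ((n - (m * t + 1)) choose (r - 1))"
  define Q where "Q = real ((n - 1) choose (r - 1))"
  define M where "M = real m"
  have M: "M \<ge> 2" unfolding M_def using m2 by simp
  have C: "C > 0" unfolding C_def by (rule C_pos)
  have Q: "Q \<le> C" unfolding Q_def C_def by (rule C_mono) simp
  have P: "(1 - (1 - p) / (32 * M)) * C \<le> P"
    unfolding C_def P_def M_def by (rule binomial_after_deletion)
  have "(M - 1) * p \<le> M - 1"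
    using p1 M by (intro mult_left_le) auto
  then have "(1 + (M - 1) * p) \<le> M" by linarith
  then have "(1 - p) / (32 * M) * C * (1 + (M - 1) * p) \<le> (1 - p) / (32 * M) * C * M"
    using M C p1 by (intro mult_left_mono) auto
  also have "\<dots> = (1 - p) / 32 * C" using M by simp
  finally have "C * (1 + (M - 1) * p) - (1 - p) / 32 * C \<le> (1 - (1 - p) / (32 * M)) * C * (1 + (M - 1) * p)"
    by (simp add: algebra_simps)
  also have "\<dots> \<le> P * (1 + (M - 1) * p)"
    using P M p0 by (intro mult_right_mono) auto
  finally have 1: "C * (1 + (M - 1) * p) - (1 - p) / 32 * C \<le> P * (1 + (M - 1) * p)" .
  have "(M - 1) * ((1 - p) / (8 * M) * C) \<le> M * ((1 - p) / (8 * M) * C)"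
    using M C p1 by (intro mult_right_mono) auto
  then have 2: "(M - 1) * ((1 - p) / (8 * M) * C) \<le> (1 - p) / 8 * C" using M by simp
  have "M * (p * Q + (1 - p) / (2 * M) * C) \<le> M * (p * C + (1 - p) / (2 * M) * C)"
    using Q M p0 by (intro mult_left_mono add_right_mono) auto
  also have "\<dots> = M * p * C + (1 - p) / 2 * C" using M by (simp add: distrib_left)
  finally have 3: "M * (p * Q + (1 - p) / (2 * M) * C) \<le> M * p * C + (1 - p) / 2 * C" .
  have "0 < (1 - p) * C" using C p1 by simp
  then have "M * (p * Q + (1 - p) / (2 * M) * C)
      < (M - 1) * (p * P - (1 - p) / (8 * M) * C) + P"
  proof -
    have "P * (1 + (M - 1) * p) = P + (M - 1) * (p * P)"
      "C * (1 + (M - 1) * p) = (1 - p) * C + M * p * C"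
      "(1 - p) / 32 * C = (1 - p) * C / 32" "(1 - p) / 8 * C = (1 - p) * C / 8"
      "(1 - p) / 2 * C = (1 - p) * C / 2"
      by (simp_all add: algebra_simps)
    then show ?thesis
      using 1 2 3 \<open>0 < (1 - p) * C\<close> unfolding right_diff_distrib[of "M - 1"] by linarith
  qed
  then have "real (t - s) * (M * threshold)
      < real (t - s) * ((M - 1) * (p * P - (1 - p) / (8 * M) * C) + P)"
    unfolding threshold_def C_def[symmetric] Q_def[symmetric] M_def[symmetric]
    using assms by (intro mult_strict_left_mono) auto
  then show ?thesis
    using ex_num_deletion[of s] assms
    unfolding C_def[symmetric] P_def[symmetric] M_def[symmetric]
    by (simp add: M_def algebra_simps)
qed

text \<open>The case \<open>s = 0\<close> of \<open>ex_num_deletion\<close>, where it suffices that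
  the gain per index is nonnegative. It shows in \<open>high_step\<close> that the remaining
  hypergraph is nearly extremal.\<close>

lemma ex_num_deletion_all:
  "real (ex_num r (n - m * t) F) \<le> real ((n choose r) - ((n - t) choose r)) + real (ex_num r (n - t) F)"
proof -
  define C where "C = real (n choose (r - 1))"
  define P where "P = real ((n - (m * t + 1)) choose (r - 1))"
  define M where "M = real m"
  have M: "M \<ge> 2" unfolding M_def using m2 by simp
  have C: "C > 0" unfolding C_def by (rule C_pos)
  have P: "(1 - (1 - p) / (32 * M)) * C \<le> P"
    unfolding C_def P_def M_def by (rule binomial_after_deletion)
  have "(1 - p) / (32 * M) \<le> 1 / 2" using M p0 p1 by (simp add: field_simps)
  then have "1 / 2 * C \<le> (1 - (1 - p) / (32 * M)) * C" using C by (intro mult_right_mono) auto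
  then have P2: "C / 2 \<le> P" using P by simp
  have "(M - 1) * ((1 - p) / (8 * M) * C) \<le> M * ((1 - p) / (8 * M) * C)"
    using M C p1 by (intro mult_right_mono) auto
  also have "\<dots> = (1 - p) / 8 * C" using M by simp
  also have "\<dots> \<le> 1 / 8 * C" using C p0 by (intro mult_right_mono) auto
  finally have 2: "(M - 1) * ((1 - p) / (8 * M) * C) \<le> C / 8" by simp
  have "0 \<le> (M - 1) * (p * P)" using M p0 P2 C by simp
  then have "0 \<le> (M - 1) * (p * P - (1 - p) / (8 * M) * C) + P"
    unfolding right_diff_distrib using 2 P2 C by linarith
  then have "0 \<le> real t * ((M - 1) * (p * P - (1 - p) / (8 * M) * C) + P)" by simp
  then show ?thesis
    using ex_num_deletion[of 0]
    unfolding C_def[symmetric] P_def[symmetric] M_def[symmetric]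
    by (simp add: algebra_simps)
qed

text \<open>Edges touching \<open>L\<close> are bounded trivially and edges touching the other
  deleted vertices by the threshold on degrees; by \<open>low_count\<close>, more than the extremal
  number of edges remain.\<close>

lemma low_step:
  assumes H: "H \<in> nvertex_rgraphs r n" and L: "L \<subseteq> verts H" "card L < t"
    and low: "\<forall>v\<in>verts H - L. real (degree H v) < threshold"
    and e: "card (edges H) \<ge> (n choose r) - ((n - t) choose r) + ex_num r (n - t) F"
    and B: "B \<subseteq> verts H - L" "card B \<le> m * (t - card L)"
  shows "contains_copy F (induced H (verts H - (L \<union> B)))"
proof -
  let ?V = "verts H" and ?s = "card L"
  have rH: "rgraph r H" "card ?V = n" "finite ?V" using H unfolding nvertex_rgraphs_def rgraph_def by auto
  have fL: "finite L" using L(1) rH(3) finite_subset by blast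
  have cVL: "card (?V - L) = n - ?s" using L(1) fL rH(2) by (simp add: card_Diff_subset)
  have "m * (t - ?s) \<le> m * t" by simp
  moreover have "t \<le> m * t" using m2 by simp
  ultimately have enough: "m * (t - ?s) \<le> n - ?s" using mt_le L(2) by linarith
  \<comment> \<open>Enlarging \<open>B\<close> to exactly \<open>m * (t - ?s)\<close> vertices fixes
    the order of the remaining hypergraph; a copy found there survives in the larger one.\<close>
  obtain B' where B': "B \<subseteq> B'" "B' \<subseteq> ?V - L" "card B' = m * (t - ?s)"
    using exists_subset_between[of B "m * (t - ?s)" "?V - L"] B enough cVL rH(3) by auto
  have fB': "finite B'" using B'(2) rH(3) finite_subset by blast
  let ?G = "induced H (?V - (L \<union> B'))"
  have "card (?V - (L \<union> B')) = n - ?s - m * (t - ?s)"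
  proof -
    have "?V - (L \<union> B') = (?V - L) - B'" by auto
    then show ?thesis using B' fB' cVL by (simp add: card_Diff_subset)
  qed
  then have G: "?G \<in> nvertex_rgraphs r (n - ?s - m * (t - ?s))"
    using induced_nvertex[OF H] by auto
  have BV: "B' \<subseteq> ?V" using B'(2) by auto
  have "L \<union> B' \<subseteq> ?V" using L(1) BV by auto
  from card_edges_split[OF rH(1) this]
  have "card (edges H) = card (edges ?G) + card {e \<in> edges H. e \<inter> (L \<union> B') \<noteq> {}}" .
  also have "{e \<in> edges H. e \<inter> (L \<union> B') \<noteq> {}} = {e \<in> edges H. e \<inter> L \<noteq> {}} \<union> {e \<in> edges H. e \<inter> B' \<noteq> {}}"
    by auto
  also have "card \<dots> \<le> card {e \<in> edges H. e \<inter> L \<noteq> {}} + card {e \<in> edges H. e \<inter> B' \<noteq> {}}"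
    by (rule card_Un_le)
  also have "\<dots> \<le> ((n choose r) - ((n - ?s) choose r)) + (\<Sum>v\<in>B'. degree H v)"
    using card_edges_meeting_le[OF rH(1) L(1)] card_edges_meeting_le_sum_degree[OF rH(1) BV] rH(2)
    by (intro add_mono) auto
  finally have c1: "card (edges H) \<le> card (edges ?G) + (((n choose r) - ((n - ?s) choose r)) + (\<Sum>v\<in>B'. degree H v))"
    by simp
  have "(\<Sum>v\<in>B'. real (degree H v)) \<le> (\<Sum>v\<in>B'. threshold)"
    using low B'(2) by (intro sum_mono less_imp_le) auto
  then have c2: "real (\<Sum>v\<in>B'. degree H v) \<le> real (m * (t - ?s)) * threshold" using B'(3) by simp
  have mono: "(n - t) choose r \<le> (n - ?s) choose r" "(n - ?s) choose r \<le> n choose r"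
    using L(2) by (auto intro!: binomial_right_mono)
  have "((n - ?s) choose r) - ((n - t) choose r) + ex_num r (n - t) F \<le> card (edges ?G) + (\<Sum>v\<in>B'. degree H v)"
    using c1 e mono by linarith
  then have "real (((n - ?s) choose r) - ((n - t) choose r)) + real (ex_num r (n - t) F)
      \<le> real (card (edges ?G)) + real (\<Sum>v\<in>B'. degree H v)"
    by (metis of_nat_add of_nat_le_iff)
  then have "real (ex_num r (n - ?s - m * (t - ?s)) F) < real (card (edges ?G))"
    using c2 low_count[OF L(2)] by linarith
  then have "\<not> free_of F ?G" using card_edges_le_ex_num[OF G] by fastforce
  then have "contains_copy F ?G" unfolding free_of_def by simp
  then show ?thesis
    by (rule contains_copy_mono) (use B'(1) in \<open>auto simp: induced_def\<close>)
qed

text \<open>This is where the condition on \<open>f\<close> enters: the left side bounds the average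
  degree lost when \<open>m * t\<close> vertices of arbitrary degree are deleted.\<close>

lemma avg_loss:
  "real r / real (n - m * t) * (real (m * t) * real ((n - 1) choose (r - 1))) \<le> f (n - m * t)"
proof -
  define M where "M = real (m * t)"
  define C where "C = real (n choose (r - 2))"
  define R where "R = real ((n - 2 * m * t) choose (r - 2))"
  have M: "M \<ge> 0" and C: "C > 0" unfolding M_def C_def using n_large by auto
  have "real (2 * m * t) * real (r - 2) / real n \<le> 2 * (real m * real t * real r / real n)"
    using r2 by (simp add: of_nat_diff divide_right_mono mult_left_mono)
  also have "\<dots> \<le> 1 / 64" using mt_r_const by linarith
  finally have "(1 - 1/64) * C \<le> (1 - real (2 * m * t) * real (r - 2) / real n) * C"
    using C by (intro mult_right_mono) auto
  also have "\<dots> \<le> R" unfolding C_def R_def by (rule binomial_diff_ge[OF n_pos(2)])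
  finally have R: "63/64 * C \<le> R" by simp
  have n'': "real (n - m * t) \<ge> 127/128 * real n"
  proof -
    have "real (256 * (m * t)) \<le> real n" using mt_le by (intro of_nat_mono)
    then show ?thesis using mt_le by (simp add: of_nat_diff)
  qed
  have e2: "exp (1::real) \<ge> 2" using exp_ge_add_one_self[of 1] by simp
  have "real (n - 1) * real ((n - 2) choose (r - 2)) = real (r - 1) * real ((n - 1) choose (r - 1))"
    using times_binomial_minus1_eq[of "r - 1" "n - 1"] r2
    by (metis (no_types, lifting) Suc_1 Suc_le_eq diff_diff_left of_nat_mult one_add_one zero_less_diff)
  \<comment> \<open>Trading \<open>r\<close> for \<open>2 * (r - 1)\<close> costs the factor 2 in
    front of \<open>exp 1\<close> and allows absorption down to lower index
    \<open>r - 2\<close>.\<close>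
  moreover have "real r \<le> 2 * real (r - 1)" using r2 by (simp add: of_nat_diff)
  ultimately have "real r * real ((n - 1) choose (r - 1)) \<le> 2 * (real (n - 1) * real ((n - 2) choose (r - 2)))"
    using mult_right_mono[of "real r" "2 * real (r - 1)" "real ((n - 1) choose (r - 1))"] by simp
  also have "\<dots> \<le> 2 * (real n * C)"
    unfolding C_def by (intro mult_left_mono mult_mono C_mono) auto
  \<comment> \<open>Of \<open>exp 1\<close> only the bound 2 is used: it outweighs the factors
    \<open>127/128\<close> and \<open>63/64\<close> lost to deletion.\<close>
  also have "real n * C \<le> 2 * (127/128 * real n) * (63/64 * C)" using C n_pos by simp
  also have "\<dots> \<le> exp 1 * real (n - m * t) * R"
    using e2 n'' R C by (intro mult_mono) auto
  finally have "real r * real ((n - 1) choose (r - 1)) \<le> 2 * exp 1 * real (n - m * t) * R" by simp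
  then have "M * (real r * real ((n - 1) choose (r - 1))) \<le> M * (2 * exp 1 * real (n - m * t) * R)"
    using M by (rule mult_left_mono)
  then have "M * (real r * real ((n - 1) choose (r - 1))) / real (n - m * t)
      \<le> M * (2 * exp 1 * real (n - m * t) * R) / real (n - m * t)"
    by (rule divide_right_mono) simp
  moreover have "real (n - m * t) \<noteq> 0" using n'' n_pos by linarith
  ultimately have "real r / real (n - m * t) * (M * real ((n - 1) choose (r - 1))) \<le> 2 * exp 1 * M * R"
    by (simp add: mult_ac del: of_nat_diff)
  also have "\<dots> \<le> f (n - 2 * m * t)" using f_large unfolding M_def R_def by (simp add: mult_ac)
  also have "\<dots> \<le> f (n - m * t)" using mono_f by (rule monoD) simp
  finally show ?thesis unfolding M_def .
qed

text \<open>If the rest were \<open>F\<close>-free, it would be nearly extremal, and boundedness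
  would limit its maximum degree. But \<open>v\<close> keeps almost all of its degree, since only
  edges that also contain a deleted vertex are lost.\<close>

lemma high_step:
  assumes H: "H \<in> nvertex_rgraphs r n"
    and e: "card (edges H) \<ge> (n choose r) - ((n - t) choose r) + ex_num r (n - t) F"
    and v: "v \<in> verts H" "threshold \<le> real (degree H v)"
    and B: "B \<subseteq> verts H - {v}" "card B \<le> m * t"
  shows "contains_copy F (induced H (verts H - B))"
proof -
  let ?V = "verts H"
  have rH: "rgraph r H" "card ?V = n" "finite ?V" using H unfolding nvertex_rgraphs_def rgraph_def by auto
  have "m * t \<le> card (?V - {v})" using mt_le rH v(1) n_large by simp
  then obtain B' where B': "B \<subseteq> B'" "B' \<subseteq> ?V - {v}" "card B' = m * t"
    using exists_subset_between[of B "m * t" "?V - {v}"] B rH(3) by auto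
  have BV: "B' \<subseteq> ?V" and vB: "v \<in> ?V - B'" using B'(2) v(1) by auto
  have fB': "finite B'" using BV rH(3) finite_subset by blast
  let ?G = "induced H (?V - B')"
  define k where "k = n - m * t"
  have "card (?V - B') = k" unfolding k_def using B' fB' BV rH(2) by (simp add: card_Diff_subset)
  then have G: "?G \<in> nvertex_rgraphs r k" using induced_nvertex[OF H] by auto
  then have rG: "rgraph r ?G" "card (verts ?G) = k" unfolding nvertex_rgraphs_def by auto
  have kN: "N \<le> k" unfolding k_def using mt_le n_large by linarith
  have k0: "k \<ge> 1" unfolding k_def using mt_le n_large by linarith
  have nfree: "\<not> free_of F ?G"
  proof
    assume free: "free_of F ?G"
    have "card {e \<in> edges H. e \<inter> B' \<noteq> {}} \<le> (\<Sum>u\<in>B'. degree H u)"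
      by (rule card_edges_meeting_le_sum_degree[OF rH(1) BV])
    also have "\<dots> \<le> (\<Sum>u\<in>B'. (n - 1) choose (r - 1))"
      using degree_le[OF rH(1)] BV r2 rH(2) by (intro sum_mono) auto
    also have "\<dots> = m * t * ((n - 1) choose (r - 1))" using B'(3) by simp
    finally have "(n choose r) - ((n - t) choose r) + ex_num r (n - t) F
        \<le> card (edges ?G) + m * t * ((n - 1) choose (r - 1))"
      using card_edges_split[OF rH(1) BV] e by linarith
    then have "real ((n choose r) - ((n - t) choose r)) + real (ex_num r (n - t) F)
        \<le> real (card (edges ?G)) + real (m * t) * real ((n - 1) choose (r - 1))"
      by (metis of_nat_add of_nat_le_iff of_nat_mult)
    then have "real (ex_num r k F) \<le> real (card (edges ?G)) + real (m * t) * real ((n - 1) choose (r - 1))"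
      using ex_num_deletion_all unfolding k_def by linarith
    then have "real r / real k * real (ex_num r k F)
        \<le> real r / real k * (real (card (edges ?G)) + real (m * t) * real ((n - 1) choose (r - 1)))"
      by (intro mult_left_mono) auto
    then have "d_ex r k F - f k \<le> avg_degree ?G"
      using avg_loss avg_degree_eq[OF rG(1)] rG(2)
      unfolding d_ex_def k_def[symmetric] by (simp add: algebra_simps)
    from bounded[OF kN G free this]
    have up: "real (max_degree ?G) \<le> d_ex r k F + (1 - p) / (4 * real m) * real (k choose (r - 1))" .
    have c: "(1 - p) / (16 * real m) \<ge> 0" "(1 - p) / (4 * real m) \<ge> 0" "(1 - p) / real m > 0"
      using p1 m2 by auto
    define C where "C = real (n choose (r - 1))"
    define Q where "Q = real ((n - 1) choose (r - 1))"
    have C: "C > 0" unfolding C_def by (rule C_pos)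
    have QC: "Q \<le> C" unfolding Q_def C_def by (rule C_mono) simp
    have "d_ex r k F \<le> (p + (1 - p) / (16 * real m)) * real ((k - 1) choose (r - 1))"
      by (rule d_upper[OF kN])
    also have "\<dots> \<le> (p + (1 - p) / (16 * real m)) * Q"
      unfolding Q_def using c p0 by (intro mult_left_mono of_nat_mono binomial_right_mono) (auto simp: k_def)
    also have "\<dots> \<le> p * Q + (1 - p) / (16 * real m) * C"
      using mult_left_mono[OF QC c(1)] by (simp add: algebra_simps)
    finally have 1: "d_ex r k F \<le> p * Q + (1 - p) / (16 * real m) * C" .
    have 2: "(1 - p) / (4 * real m) * real (k choose (r - 1)) \<le> (1 - p) / (4 * real m) * C"
      unfolding C_def using c(2) by (intro mult_left_mono C_mono) (auto simp: k_def)
    have "real (m * t) * real ((n - 2) choose (r - 2)) \<le> real (m * t) * real ((n - 1) choose (r - 2))"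
      by (intro mult_left_mono of_nat_mono binomial_right_mono) auto
    also have "\<dots> = real (m * t) * real (r - 1) / real n * C"
      unfolding C_def using binomial_minus1_eq[of "r - 1" n] r2 n_pos
      by (simp add: numeral_2_eq_2)
    also have "\<dots> \<le> (1 - p) / (64 * real m) * C"
    proof (rule mult_right_mono)
      have "real (m * t) * real (r - 1) / real n \<le> real m * real t * real r / real n"
        by (simp add: divide_right_mono mult_left_mono)
      then show "real (m * t) * real (r - 1) / real n \<le> (1 - p) / (64 * real m)"
        using mt_r by linarith
    qed (use C in auto)
    finally have 3: "real (m * t) * real ((n - 2) choose (r - 2)) \<le> (1 - p) / (64 * real m) * C" .
    have "degree H v \<le> degree ?G v + m * t * ((n - 2) choose (r - 2))"
      using degree_induced_ge[OF rH(1) BV vB r2] rH(2) B'(3) by simp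
    then have "real (degree H v) \<le> real (degree ?G v) + real (m * t) * real ((n - 2) choose (r - 2))"
      by (metis of_nat_add of_nat_le_iff of_nat_mult)
    moreover have "degree ?G v \<le> max_degree ?G"
      using degree_le_max_degree[OF rG(1)] vB by (simp add: induced_def)
    ultimately have "threshold \<le> real (max_degree ?G) + (1 - p) / (64 * real m) * C"
      using 3 v(2) by linarith
    \<comment> \<open>The three errors come from \<open>d_upper\<close>, from \<open>bounded\<close>
      and from the edges lost at \<open>v\<close>; since \<open>1/16 + 1/4 + 1/64 < 1/2\<close>,
      this is a contradiction.\<close>
    then have "(1 - p) / (2 * real m) * C
        \<le> (1 - p) / (16 * real m) * C + (1 - p) / (4 * real m) * C + (1 - p) / (64 * real m) * C"
      using up 1 2 unfolding threshold_def C_def[symmetric] Q_def[symmetric] by linarith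
    moreover have "(1 - p) / (2 * real m) * C = (1 - p) / real m * C / 2"
        "(1 - p) / (16 * real m) * C = (1 - p) / real m * C / 16"
        "(1 - p) / (4 * real m) * C = (1 - p) / real m * C / 4"
        "(1 - p) / (64 * real m) * C = (1 - p) / real m * C / 64" by simp_all
    moreover have "(1 - p) / real m * C > 0" using c(3) C by (rule mult_pos_pos)
    ultimately show False by linarith
  qed
  then have "contains_copy F ?G" unfolding free_of_def by simp
  then show ?thesis
    by (rule contains_copy_mono) (use B'(1) in \<open>auto simp: induced_def\<close>)
qed

lemma rainbow_matching_or_free_of_many_edges:
  fixes V :: "nat set"
  assumes "\<forall>i\<in>{1..t + 1}. \<H> i \<in> nvertex_rgraphs r n \<and> verts (\<H> i) = V \<and>
         card (edges (\<H> i)) \<ge> (n choose r) - ((n - t) choose r) + ex_num r (n - t) F"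
  shows "contains_rainbow_matching F (t+1) V \<H> \<or>
         (\<exists>j\<in>{1..t+1}. \<exists>L\<subseteq>V. card L = t \<and> free_of F (induced (\<H> j) (V - L)))"
proof (rule rainbow_matching_or_free[where high = "\<lambda>i v. threshold \<le> real (degree (\<H> i) v)"])
  have A: "\<H> i \<in> nvertex_rgraphs r n" "verts (\<H> i) = V"
      "card (edges (\<H> i)) \<ge> (n choose r) - ((n - t) choose r) + ex_num r (n - t) F"
    if "i \<in> {1..t+1}" for i using assms that by blast+
  show "finite V" using A(1,2)[of 1] unfolding nvertex_rgraphs_def rgraph_def by auto
  show "card (verts F) = m" "1 \<le> m" using card_F m2 by auto
  show "verts (\<H> i) = V" if "i \<in> {1..t+1}" for i using A(2)[OF that] .
  show "contains_copy F (induced (\<H> i) (V - B))"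
    if "i \<in> {1..t+1}" "v \<in> V" "threshold \<le> real (degree (\<H> i) v)" "B \<subseteq> V - {v}" "card B \<le> m * t" for i v B
    using high_step[OF A(1)[OF that(1)] A(3)[OF that(1)]] that A(2)[OF that(1)] by auto
  show "contains_copy F (induced (\<H> i) (V - (L \<union> B)))"
    if "i \<in> {1..t+1}" "L \<subseteq> V" "card L < t" "\<forall>v\<in>V - L. \<not> threshold \<le> real (degree (\<H> i) v)"
      "B \<subseteq> V - L" "card B \<le> m * (t - card L)" for i L B
    using low_step[OF A(1)[OF that(1)], of L B] A(2,3)[OF that(1)] that(2-6) by (simp add: not_le)
qed

end

section \<open>Assembly of the theorem\<close>

lemma contains_rainbow_matching_1:
  assumes "contains_copy F (induced (\<H> 1) V)"
  shows "contains_rainbow_matching F 1 V \<H>"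
proof -
  obtain S where "S \<subseteq> V" "card S = card (verts F)" "contains_copy F (induced (\<H> 1) S)"
    using assms by (rule contains_copy_inducedE)
  then show ?thesis
    unfolding contains_rainbow_matching_def
    by (intro exI[of _ "\<lambda>_. S"]) (auto simp: disjoint_family_on_def)
qed

theorem theorem3p1:
  fixes m r :: nat and F :: "'a hypergraph" and f :: "nat \<Rightarrow> real"
  assumes "r \<ge> 2" and "m \<ge> r"
    and "rgraph r F" and "card (verts F) = m"
    and "nondegenerate r F"
    and "mono f"
    and "eventually (\<lambda>n.
           \<bar>delta_ex r n F - d_ex r (n - 1) F\<bar>
             \<le> (1 - turan_density r F) / (8 * real m) * real (n choose (r - 1))) sequentially"
    and "eventually (\<lambda>n. \<forall>H\<in>nvertex_rgraphs r n.
           free_of F H \<longrightarrow> avg_degree H \<ge> d_ex r n F - f n \<longrightarrow>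
           real (max_degree H)
             \<le> d_ex r n F + (1 - turan_density r F) / (4 * real m) * real (n choose (r - 1))) sequentially"
  shows "\<exists>N0. \<forall>n t :: nat.
           n \<ge> N0 \<longrightarrow>
           real t \<le> (1 - turan_density r F) / (64 * real r * (real m)^2) * real n \<longrightarrow>
           2 * exp 1 * real m * real t * real ((n - 2 * m * t) choose (r - 2)) \<le> f (n - 2 * m * t) \<longrightarrow>
             (\<forall>(V :: nat set) (\<H> :: nat \<Rightarrow> nat hypergraph).
                (\<forall>i\<in>{1..t + 1}. \<H> i \<in> nvertex_rgraphs r n \<and> verts (\<H> i) = V \<and>
                   card (edges (\<H> i)) > (n choose r) - ((n - t) choose r) + ex_num r (n - t) F) \<longrightarrow>
                contains_rainbow_matching F (t + 1) V \<H>) \<and>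
             EX_matching r n (t + 1) F = join_family r (complete_rgraphs r t) (EX_graphs r (n - t) F)"
proof -
  let ?p = "turan_density r F"
  have r1: "r \<ge> 1" and m: "m \<ge> 2" using assms(1,2) by auto
  have F: "finite (verts F)" "verts F \<noteq> {}"
    using assms(3,4) m unfolding rgraph_def by auto
  have eF: "edges F \<noteq> {}" by (rule nondegenerate_edges_nonempty[OF assms(5) r1 F(1)])
  have p0: "?p > 0" using assms(5) unfolding nondegenerate_def .
  have p1: "?p \<le> 1" by (rule turan_density_le_1[OF eF])
  \<comment> \<open>The guard is needed because density 1 would leave no positive margin for
    \<open>eventually_d_ex_le\<close>.\<close>
  have "\<forall>\<^sub>F k in sequentially. ?p < 1 \<longrightarrow>
      d_ex r k F \<le> (?p + (1 - ?p) / (16 * real m)) * real ((k - 1) choose (r - 1))"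
  proof (cases "?p < 1")
    case True
    then have "(1 - ?p) / (16 * real m) > 0" using m by simp
    from eventually_d_ex_le[OF eF r1 this] show ?thesis by (rule eventually_mono) blast
  qed simp
  from eventually_conj[OF this eventually_conj[OF assms(7,8)]]
  obtain N where N: "\<And>k. N \<le> k \<Longrightarrow>
      (?p < 1 \<longrightarrow> d_ex r k F \<le> (?p + (1 - ?p) / (16 * real m)) * real ((k - 1) choose (r - 1))) \<and>
      \<bar>delta_ex r k F - d_ex r (k - 1) F\<bar> \<le> (1 - ?p) / (8 * real m) * real (k choose (r - 1)) \<and>
      (\<forall>H\<in>nvertex_rgraphs r k. free_of F H \<longrightarrow> avg_degree H \<ge> d_ex r k F - f k \<longrightarrow>
           real (max_degree H) \<le> d_ex r k F + (1 - ?p) / (4 * real m) * real (k choose (r - 1)))"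
    unfolding eventually_sequentially by blast
  \<comment> \<open>The term \<open>2 * N\<close> keeps the order at least \<open>N\<close> after
    all deletions. For density 1 the quotient is 0 by the convention on division, harmlessly, since
    then \<open>t = 0\<close>.\<close>
  define N0 where "N0 = max (2 * N + 2 * r + 2) (nat \<lceil>64 * real r * real m / (1 - ?p)\<rceil>)"
  show ?thesis
  proof (intro exI[of _ N0] allI impI)
    fix n t :: nat
    assume n: "n \<ge> N0" and t: "real t \<le> (1 - ?p) / (64 * real r * (real m)^2) * real n"
      and f: "2 * exp 1 * real m * real t * real ((n - 2 * m * t) choose (r - 2)) \<le> f (n - 2 * m * t)"
    have dichotomy: "t \<le> n \<and> (\<forall>V \<H>. (\<forall>i\<in>{1..t + 1}. \<H> i \<in> nvertex_rgraphs r n \<and> verts (\<H> i) = V \<and>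
         card (edges (\<H> i)) \<ge> (n choose r) - ((n - t) choose r) + ex_num r (n - t) F) \<longrightarrow>
      contains_rainbow_matching F (t+1) V \<H> \<or>
         (\<exists>j\<in>{1..t+1}. \<exists>L\<subseteq>V. card L = t \<and> free_of F (induced (\<H> j) (V - L))))"
    proof (cases "t = 0")
      case True
      show ?thesis
      proof (intro conjI allI impI)
        fix V :: "nat set" and \<H>
        show "contains_rainbow_matching F (t+1) V \<H> \<or>
         (\<exists>j\<in>{1..t+1}. \<exists>L\<subseteq>V. card L = t \<and> free_of F (induced (\<H> j) (V - L)))"
          \<comment> \<open>For \<open>t = 0\<close> the dichotomy is immediate with
            \<open>L = {}\<close>: either the single hypergraph contains a copy or it is
            \<open>F\<close>-free.\<close>
          using True contains_rainbow_matching_1[of F \<H> V] unfolding free_of_def by force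
      qed (use True in simp)
    next
      case False
      have "?p < 1"
      proof (rule ccontr)
        assume "\<not> ?p < 1"
        then have "?p = 1" using p1 by simp
        then show False using t False by simp
      qed
      have "64 * real r * real m / (1 - ?p) \<le> real (nat \<lceil>64 * real r * real m / (1 - ?p)\<rceil>)"
        by (rule real_nat_ceiling_ge)
      also have "\<dots> \<le> real n" using n unfolding N0_def by simp
      finally have nl: "64 * real r * real m / (1 - ?p) \<le> real n" .
      have "2 * N + 2 * r + 2 \<le> n" using n unfolding N0_def by simp
      then interpret matching_setup F f r m n t N ?p
        using assms(1,2,4,6) eF p0 N \<open>?p < 1\<close> nl t f False by unfold_locales auto
      have "t \<le> m * t" using m by simp
      then have "t \<le> n" using mt_le by linarith
      then show ?thesis using rainbow_matching_or_free_of_many_edges by blast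
    qed
    show "(\<forall>(V :: nat set) (\<H> :: nat \<Rightarrow> nat hypergraph).
                (\<forall>i\<in>{1..t + 1}. \<H> i \<in> nvertex_rgraphs r n \<and> verts (\<H> i) = V \<and>
                   card (edges (\<H> i)) > (n choose r) - ((n - t) choose r) + ex_num r (n - t) F) \<longrightarrow>
                contains_rainbow_matching F (t + 1) V \<H>) \<and>
             EX_matching r n (t + 1) F = join_family r (complete_rgraphs r t) (EX_graphs r (n - t) F)"
      by (rule rainbow_and_extremal_of_dichotomy[OF r1 F(2,1) eF]) (use dichotomy in blast)+
  qed
qed

end
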